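(* Let $n,m\ge2$. Let $\psi:\mathcal C_n\to\mathcal C_m$ be a homeomorphism preserving or reversing lexicographic order, let $\mathcal A$ be a full $n$-ary tree-automaton, and put $H=\mathcal D(\mathcal A)\le F_n$. Then the forward automaton $\mathcal F_\psi(\mathcal A)$ satisfies $$\mathcal D(\mathcal F_\psi(\mathcal A))=H^\psi\cap F_m .$$ In particular, if $H^\psi\le F_m$, then $\mathcal D(\mathcal F_\psi(\mathcal A))=H^\psi$.
   Context: Let $X_n=\{0,\dots,n-1\}$, $\mathcal W_n=X_n^*$ (including the empty word $\varepsilon$), $\mathcal C_n=X_n^{\mathbb N}$ with the lexicographic order, $U_u=u\mathcal C_n$. $F_n$ is the group of order-preserving homeomorphisms $f$ of $\mathcal C_n$ for which there are finite complete prefix codes $\{u_1<\dots<u_k\}$, $\{v_1<\dots<v_k\}$ in $\mathcal W_n$ (complete: their cylinders partition $\mathcal C_n$) with $f(u_i\omega)=v_i\omega$. Such a pair of codes is a tree diagram of $f$ with branch pairs $u_i\to v_i$. $H^\psi=\{\omega\mapsto\psi(h(\psi^{-1}(\omega))):h\in H\}$. An $n$-ary tree-automaton is $\mathcal A=(Q,\tau,q_0)$ with state set $Q$ (possibly infinite), root $q_0$, and partial transition function $\tau:Q\times X_n\dashrightarrow Q$, extended to words in the usual way, such that every state is $\tau(q_0,u)$ for some word $u$ and each state has either no outgoing transitions or a transition for every letter. It is full if every state has all $n$ transitions. A tree diagram with branch pairs $u_i\to v_i$ is accepted if $\tau(q_0,u_i)$ and $\tau(q_0,v_i)$ are defined and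 equal for every $i$. $\mathcal D(\mathcal A)$ is the subgroup of elements of $F_n$ admitting at least one accepted tree diagram. For a continuous injective $f:\mathcal C_n\to\mathcal C_m$ and $u\in\mathcal W_n$, let $\theta_f(u)$ be the greatest common prefix of $f(U_u)$, and let the local action $f_u$ be defined by $f(u\omega)=\theta_f(u)f_u(\omega)$. The minimal transducer of $\psi$ is $T^\psi=(S_\psi,t_\psi,o_\psi,s_\psi)$ with $S_\psi=\{\psi_u:u\in\mathcal W_n\}$, $s_\psi=\psi$, $t_\psi(f,i)=f_i$, $o_\psi(f,i)=\theta_f(i)$. Forward automaton. Take the directed graph on $S_\psi\times Q$ with an edge $(s,q)\to(t_\psi(s,i),\tau(q,i))$ labelled by the word $o_\psi(s,i)\in\mathcal W_m$ for each state $(s,q)$ and each $i\in X_n$, and restrict to the part reachable from $(s_\psi,q_0)$. Subdivide: each edge labelled by a word $b_1\cdots b_k$ with $k\ge2$ is replaced by a path of $k$ edges labelled $b_1,\dots,b_k$ through $k-1$ new vertices private to that edge; edges labelled by $\varepsilon$ or a single letter are kept. For $x\in\mathcal W_m$ let $R_x$ be the set of all vertices (old or new) reachable from $(s_\psi,q_0)$ by a path whose label (concatenation of edge labels, with $\varepsilon$'s deleted) is exactly $x$. $\mathcal F_\psi(\mathcal A)$ is the deterministic $m$-ary automaton whose states are the sets $R_x$ ($x\in\mathcal W_m$; equal sets are the same state), with root $R_\varepsilon$ and transitions $R_x\cdot b=R_{xb}$ for $b\in X_m$. It is a full $m$-ary tree-automaton. *)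

theory Defs
  imports
    "HOL-Analysis.Analysis"
    "HOL-Library.Fun_Lexorder"
    "HOL-Library.Omega_Words_Fun"
    "HOL-Library.Sublist"
begin

section \<open>Words and Cantor space\<close>

text \<open>
  Letters are natural numbers, $X_n = \{0,\dots,n-1\}$. The set \<open>cantor n\<close> carries the subspace
  topology of the type \<open>nat \<Rightarrow> nat\<close>, whose topology is the product topology of discrete
  factors. The lexicographic order on infinite words is \<^const>\<open>less_fun\<close>; on finite words
  it is \<^const>\<open>ord_class.lexordp\<close>.
\<close>

definition words :: "nat \<Rightarrow> nat list set" where
  "words n = lists {..<n}"

definition cantor :: "nat \<Rightarrow> (nat \<Rightarrow> nat) set" where
  "cantor n = {\<omega>. \<forall>k. \<omega> k < n}"

definition cylinder :: "nat \<Rightarrow> nat list \<Rightarrow> (nat \<Rightarrow> nat) set" where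
  "cylinder n u = (\<lambda>\<omega>. u \<frown> \<omega>) ` cantor n"

section \<open>The groups $F_n$\<close>

text \<open>A code $\{u_1 < \dots < u_k\}$ is given by the list $u_1,\dots,u_k$.\<close>

definition complete_prefix_code :: "nat \<Rightarrow> nat list list \<Rightarrow> bool" where
  "complete_prefix_code n us \<longleftrightarrow>
     set us \<subseteq> words n \<and>
     sorted_wrt ord_class.lexordp us \<and>
     pairwise (\<lambda>u v. \<not> Sublist.prefix u v) (set us) \<and>
     partition_on (cantor n) (cylinder n ` set us)"

definition tree_diagram ::
    "nat \<Rightarrow> nat list list \<Rightarrow> nat list list \<Rightarrow> ((nat \<Rightarrow> nat) \<Rightarrow> (nat \<Rightarrow> nat)) \<Rightarrow> bool" where
  "tree_diagram n us vs f \<longleftrightarrow>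
     complete_prefix_code n us \<and> complete_prefix_code n vs \<and> length us = length vs \<and>
     (\<forall>i < length us. \<forall>\<omega> \<in> cantor n. f (us ! i \<frown> \<omega>) = vs ! i \<frown> \<omega>)"

text \<open>
  Self-maps of $\mathcal C_n$ are represented by functions that are \<^const>\<open>undefined\<close> outside
  \<open>cantor n\<close>, so that equality of functions is equality of maps on $\mathcal C_n$.
\<close>

definition thompson_F :: "nat \<Rightarrow> ((nat \<Rightarrow> nat) \<Rightarrow> (nat \<Rightarrow> nat)) set" where
  "thompson_F n =
     {f \<in> extensional (cantor n).
        (\<exists>g. homeomorphism (cantor n) (cantor n) f g) \<and>
        monotone_on (cantor n) less_fun less_fun f \<and>
        (\<exists>us vs. tree_diagram n us vs f)}"

definition conjugate ::
    "nat \<Rightarrow> nat \<Rightarrow> ((nat \<Rightarrow> nat) \<Rightarrow> (nat \<Rightarrow> nat)) \<Rightarrow>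
     ((nat \<Rightarrow> nat) \<Rightarrow> (nat \<Rightarrow> nat)) set \<Rightarrow> ((nat \<Rightarrow> nat) \<Rightarrow> (nat \<Rightarrow> nat)) set" where
  "conjugate n m \<psi> H =
     (\<lambda>h. restrict (\<lambda>\<omega>. \<psi> (h (inv_into (cantor n) \<psi> \<omega>))) (cantor m)) ` H"

section \<open>Tree-automata\<close>

record 'q automaton =
  states :: "'q set"
  delta :: "'q \<times> nat \<rightharpoonup> 'q"
  root :: 'q

primrec run :: "'q automaton \<Rightarrow> 'q \<Rightarrow> nat list \<Rightarrow> 'q option" where
  "run A q [] = Some q"
| "run A q (i # u) = Option.bind (delta A (q, i)) (\<lambda>q'. run A q' u)"

definition tree_automaton :: "nat \<Rightarrow> 'q automaton \<Rightarrow> bool" where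
  "tree_automaton n A \<longleftrightarrow>
     root A \<in> states A \<and>
     dom (delta A) \<subseteq> states A \<times> {..<n} \<and>
     ran (delta A) \<subseteq> states A \<and>
     (\<forall>q \<in> states A. \<exists>u \<in> words n. run A (root A) u = Some q) \<and>
     (\<forall>q \<in> states A. (\<forall>i < n. delta A (q, i) = None) \<or> (\<forall>i < n. delta A (q, i) \<noteq> None))"

definition full_tree_automaton :: "nat \<Rightarrow> 'q automaton \<Rightarrow> bool" where
  "full_tree_automaton n A \<longleftrightarrow>
     tree_automaton n A \<and> (\<forall>q \<in> states A. \<forall>i < n. delta A (q, i) \<noteq> None)"

definition accepted :: "'q automaton \<Rightarrow> nat list list \<Rightarrow> nat list list \<Rightarrow> bool" where
  "accepted A us vs \<longleftrightarrow>
     (\<forall>i < length us. run A (root A) (us ! i) \<noteq> None \<and>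
        run A (root A) (us ! i) = run A (root A) (vs ! i))"

definition diagram_group :: "nat \<Rightarrow> 'q automaton \<Rightarrow> ((nat \<Rightarrow> nat) \<Rightarrow> (nat \<Rightarrow> nat)) set" where
  "diagram_group n A =
     {f \<in> thompson_F n. \<exists>us vs. tree_diagram n us vs f \<and> accepted A us vs}"

section \<open>The minimal transducer\<close>

definition common_prefix :: "nat list \<Rightarrow> (nat \<Rightarrow> nat) set \<Rightarrow> bool" where
  "common_prefix w S \<longleftrightarrow> (\<forall>\<omega> \<in> S. \<exists>\<omega>'. \<omega> = w \<frown> \<omega>')"

definition greatest_common_prefix :: "(nat \<Rightarrow> nat) set \<Rightarrow> nat list" where
  "greatest_common_prefix S =
     (THE w. common_prefix w S \<and> (\<forall>v. common_prefix v S \<longrightarrow> Sublist.prefix v w))"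

definition theta :: "nat \<Rightarrow> ((nat \<Rightarrow> nat) \<Rightarrow> (nat \<Rightarrow> nat)) \<Rightarrow> nat list \<Rightarrow> nat list" where
  "theta n f u = greatest_common_prefix (f ` cylinder n u)"

definition local_action ::
    "nat \<Rightarrow> ((nat \<Rightarrow> nat) \<Rightarrow> (nat \<Rightarrow> nat)) \<Rightarrow> nat list \<Rightarrow> (nat \<Rightarrow> nat) \<Rightarrow> (nat \<Rightarrow> nat)" where
  "local_action n f u =
     restrict (\<lambda>\<omega>. Omega_Words_Fun.suffix (length (theta n f u)) (f (u \<frown> \<omega>))) (cantor n)"

record 's transducer =
  tstates :: "'s set"
  tstep :: "'s \<Rightarrow> nat \<Rightarrow> 's"
  toutput :: "'s \<Rightarrow> nat \<Rightarrow> nat list"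
  tstart :: 's

definition minimal_transducer ::
    "nat \<Rightarrow> ((nat \<Rightarrow> nat) \<Rightarrow> (nat \<Rightarrow> nat)) \<Rightarrow> ((nat \<Rightarrow> nat) \<Rightarrow> (nat \<Rightarrow> nat)) transducer" where
  "minimal_transducer n \<psi> =
     \<lparr> tstates = {local_action n \<psi> u | u. u \<in> words n},
       tstep = (\<lambda>f i. local_action n f [i]),
       toutput = (\<lambda>f i. theta n f [i]),
       tstart = restrict \<psi> (cantor n) \<rparr>"

section \<open>The forward automaton\<close>

text \<open>\<open>product_edge n T A (s, q) i (s', q')\<close>: the edge with index \<open>i\<close> out of \<open>(s, q)\<close> leads to
  \<open>(s', q')\<close>; its label is \<open>toutput T s i\<close>.\<close>

definition product_edge ::
    "nat \<Rightarrow> 's transducer \<Rightarrow> 'q automaton \<Rightarrow> 's \<times> 'q \<Rightarrow> nat \<Rightarrow> 's \<times> 'q \<Rightarrow> bool" where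
  "product_edge n T A p i p' \<longleftrightarrow>
     p \<in> tstates T \<times> states A \<and> i < n \<and>
     fst p' = tstep T (fst p) i \<and> delta A (snd p, i) = Some (snd p')"

definition reachable :: "nat \<Rightarrow> 's transducer \<Rightarrow> 'q automaton \<Rightarrow> 's \<times> 'q \<Rightarrow> bool" where
  "reachable n T A = (\<lambda>p p'. \<exists>i. product_edge n T A p i p')\<^sup>*\<^sup>* (tstart T, root A)"

text \<open>\<open>Inner p i j\<close> is the \<open>j\<close>-th inner vertex on the subdivided edge with index \<open>i\<close> out of \<open>p\<close>;
  only \<open>0 < j < k\<close> occurs, where \<open>k\<close> is the length of the label of that edge.\<close>

datatype ('s, 'q) vertex = Old "'s \<times> 'q" | Inner "'s \<times> 'q" nat nat

inductive labelled_edge ::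
    "nat \<Rightarrow> 's transducer \<Rightarrow> 'q automaton \<Rightarrow>
     ('s, 'q) vertex \<Rightarrow> nat list \<Rightarrow> ('s, 'q) vertex \<Rightarrow> bool"
  for n :: nat and T :: "'s transducer" and A :: "'q automaton" where
  kept: "\<lbrakk> reachable n T A p; product_edge n T A p i p'; w = toutput T (fst p) i; length w \<le> 1 \<rbrakk>
     \<Longrightarrow> labelled_edge n T A (Old p) w (Old p')"
| subdivided: "\<lbrakk> reachable n T A p; product_edge n T A p i p'; w = toutput T (fst p) i;
       length w \<ge> 2; j < length w \<rbrakk>
     \<Longrightarrow> labelled_edge n T A
           (if j = 0 then Old p else Inner p i j)
           [w ! j]
           (if Suc j = length w then Old p' else Inner p i (Suc j))"

inductive labelled_path ::
    "('v \<Rightarrow> 'a list \<Rightarrow> 'v \<Rightarrow> bool) \<Rightarrow> 'v \<Rightarrow> 'a list \<Rightarrow> 'v \<Rightarrow> bool"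
  for E :: "'v \<Rightarrow> 'a list \<Rightarrow> 'v \<Rightarrow> bool" where
  path_nil: "labelled_path E v [] v"
| path_step: "\<lbrakk> labelled_path E u x v; E v y w \<rbrakk> \<Longrightarrow> labelled_path E u (x @ y) w"

definition reach_set ::
    "nat \<Rightarrow> 's transducer \<Rightarrow> 'q automaton \<Rightarrow> nat list \<Rightarrow> ('s, 'q) vertex set" where
  "reach_set n T A x =
     {v. labelled_path (labelled_edge n T A) (Old (tstart T, root A)) x v}"

text \<open>The successor of $R_x$ under $b$ is $R_{xb}$. The description in \<open>subset_automaton\<close> is
  independent of the choice of \<open>x\<close>, see \<open>subset_automaton_delta\<close> below.\<close>

definition subset_automaton ::
    "nat \<Rightarrow> nat \<Rightarrow> 's transducer \<Rightarrow> 'q automaton \<Rightarrow> ('s, 'q) vertex set automaton" where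
  "subset_automaton n m T A =
     \<lparr> states = reach_set n T A ` words m,
       delta = (\<lambda>(P, b). Some (THE P'. \<exists>x \<in> words m.
                    P = reach_set n T A x \<and> P' = reach_set n T A (x @ [b])))
                 |` (reach_set n T A ` words m \<times> {..<m}),
       root = reach_set n T A [] \<rparr>"

definition forward_automaton ::
    "nat \<Rightarrow> nat \<Rightarrow> ((nat \<Rightarrow> nat) \<Rightarrow> (nat \<Rightarrow> nat)) \<Rightarrow> 'q automaton \<Rightarrow>
     ((nat \<Rightarrow> nat) \<Rightarrow> (nat \<Rightarrow> nat), 'q) vertex set automaton" where
  "forward_automaton n m \<psi> A = subset_automaton n m (minimal_transducer n \<psi>) A"


lemma labelled_path_trans:
  assumes "labelled_path E v y w" "labelled_path E u x v"
  shows "labelled_path E u (x @ y) w"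
  using assms by induction (simp, metis append_assoc labelled_path.path_step)

lemma labelled_path_snoc_split:
  assumes "labelled_path E u z w" "z = x @ [b]" "\<And>v y v'. E v y v' \<Longrightarrow> length y \<le> 1"
  shows "\<exists>v. labelled_path E u x v \<and> labelled_path E v [b] w"
  using assms(1,2)
proof (induction arbitrary: x)
  case (path_step u z v y w)
  show ?case
  proof (cases y)
    case Nil
    then obtain v' where "labelled_path E u x v'" "labelled_path E v' [b] v"
      using path_step.IH path_step.prems by auto
    then show ?thesis
      using labelled_path.path_step[of E v' "[b]" v y w] path_step.hyps Nil by auto
  next
    case (Cons c cs)
    then have "cs = []"
      using assms(3)[OF path_step.hyps(2)] by auto
    then show ?thesis
      using path_step.hyps path_step.prems Cons labelled_path.path_step[OF path_nil, of E v "[c]" w] by auto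
  qed
qed simp

lemma labelled_edge_length: "labelled_edge n T A v y v' \<Longrightarrow> length y \<le> 1"
  by (induction rule: labelled_edge.induct) auto

lemma reach_set_snoc:
  "reach_set n T A (x @ [b]) =
     {w. \<exists>v \<in> reach_set n T A x. labelled_path (labelled_edge n T A) v [b] w}"
proof -
  have "labelled_path (labelled_edge n T A) u (x @ [b]) w \<longleftrightarrow>
      (\<exists>v. labelled_path (labelled_edge n T A) u x v \<and> labelled_path (labelled_edge n T A) v [b] w)"
    for u w
  proof
    assume "labelled_path (labelled_edge n T A) u (x @ [b]) w"
    from labelled_path_snoc_split[OF this refl labelled_edge_length]
    show "\<exists>v. labelled_path (labelled_edge n T A) u x v \<and>
        labelled_path (labelled_edge n T A) v [b] w" .
  qed (metis labelled_path_trans)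
  then show ?thesis
    unfolding reach_set_def by auto
qed

lemma subset_automaton_delta:
  assumes "x \<in> words m" "b < m"
  shows "delta (subset_automaton n m T A) (reach_set n T A x, b) = Some (reach_set n T A (x @ [b]))"
proof -
  have "(THE P'. \<exists>y \<in> words m. reach_set n T A x = reach_set n T A y \<and>
          P' = reach_set n T A (y @ [b])) = reach_set n T A (x @ [b])"
    by (rule the_equality) (use assms in \<open>auto simp: reach_set_snoc\<close>)
  then show ?thesis
    using assms by (simp add: subset_automaton_def restrict_map_def)
qed

lemma run_append: "run A q (u @ v) = Option.bind (run A q u) (\<lambda>q'. run A q' v)"
  by (induction u arbitrary: q) (auto simp: Option.bind_assoc)

lemma run_subset_automaton:
  "x \<in> words m \<Longrightarrow>
     run (subset_automaton n m T A) (root (subset_automaton n m T A)) x = Some (reach_set n T A x)"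
proof (induction x rule: rev_induct)
  case Nil
  then show ?case by (simp add: subset_automaton_def)
next
  case (snoc b x)
  then have "x \<in> words m" "b < m" by (auto simp: words_def)
  then show ?case
    using snoc.IH by (simp add: run_append subset_automaton_delta)
qed

lemma full_tree_automaton_subset_automaton: "full_tree_automaton m (subset_automaton n m T A)"
proof -
  let ?B = "subset_automaton n m T A"
  have st: "states ?B = reach_set n T A ` words m" and rt: "root ?B = reach_set n T A []"
    by (auto simp: subset_automaton_def)
  have dom: "dom (delta ?B) \<subseteq> states ?B \<times> {..<m}"
    by (auto simp: subset_automaton_def restrict_map_def split: if_splits)
  have step: "\<exists>y \<in> words m. delta ?B (P, b) = Some (reach_set n T A y)"
    if P: "P \<in> states ?B" and b: "b < m" for P b
  proof -
    obtain x where "x \<in> words m" "P = reach_set n T A x"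
      using P unfolding st by blast
    moreover from this have "x @ [b] \<in> words m"
      using b by (simp add: words_def)
    ultimately show ?thesis
      using b subset_automaton_delta by blast
  qed
  have "ran (delta ?B) \<subseteq> states ?B"
  proof
    fix P' assume "P' \<in> ran (delta ?B)"
    then obtain P b where Pb: "delta ?B (P, b) = Some P'"
      by (auto simp: ran_def)
    then have "P \<in> states ?B" "b < m"
      using dom by auto
    then show "P' \<in> states ?B"
      using step[of P b] Pb st by auto
  qed
  moreover have "root ?B \<in> states ?B"
    by (auto simp: st rt words_def)
  moreover have "\<forall>P \<in> states ?B. \<exists>u \<in> words m. run ?B (root ?B) u = Some P"
    unfolding st using run_subset_automaton by blast
  moreover have "\<forall>P \<in> states ?B. \<forall>i < m. delta ?B (P, i) \<noteq> None"
    using step by blast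
  ultimately show ?thesis
    using dom unfolding full_tree_automaton_def tree_automaton_def by blast
qed

end

theory Submission
  imports Defs "HOL-Library.List_Lexorder"
begin

text \<open>
  Write $q_u$ for the state of $\mathcal A$ after reading $u$. Since $\psi(u\omega) =
  \theta_\psi(u)\psi_u(\omega)$, the set $R_x$ consists of the pairs $(\psi_u, q_u)$ with
  $\theta_\psi(u) = x$ and of the inner vertices on the edges out of those $(\psi_u, q_u)$ for
  which $x$ lies strictly between $\theta_\psi(u)$ and some $\theta_\psi(ui)$.

  If $f(x\xi) = y\xi$ and $R_x = R_y$, then any $u$ contributing to $R_x$ has a partner $v$ with
  the same local action and state contributing to $R_y$, so that $\psi^{-1}f\psi$ maps $u\eta$ to
  $v\eta$ (or $ui\eta$ to $vi\eta$). Conversely, if $h = \psi^{-1}f\psi$ has an accepted diagram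
  and $z$ is long, then every word $w$ contributing to $R_{xz}$ is so long that $h$ exchanges it
  for a word $w'$ with the same state; then $w'$ has the same local action as $w$ and contributes
  to $R_{yz}$. By compactness of $\mathcal C_n$, an element of $F_n$ lies in the diagram group as
  soon as every point has a neighbourhood on which it is such an accepted prefix exchange.
\<close>
section \<open>Words, cylinders and compactness\<close>

lemma words_append [simp]: "u @ v \<in> words n \<longleftrightarrow> u \<in> words n \<and> v \<in> words n"
  by (auto simp: words_def)

lemma words_Nil [simp]: "[] \<in> words n"
  by (simp add: words_def)

lemma words_Cons [simp]: "i # u \<in> words n \<longleftrightarrow> i < n \<and> u \<in> words n"
  by (auto simp: words_def)

lemma conc_in_cantor [simp]: "u \<frown> \<omega> \<in> cantor n \<longleftrightarrow> u \<in> words n \<and> \<omega> \<in> cantor n"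
proof -
  have "\<eta> \<in> cantor n \<longleftrightarrow> range \<eta> \<subseteq> {..<n}" for \<eta>
    by (auto simp: cantor_def)
  then show ?thesis
    by (auto simp: words_def)
qed

lemma suffix_in_cantor [simp]: "\<omega> \<in> cantor n \<Longrightarrow> Omega_Words_Fun.suffix k \<omega> \<in> cantor n"
  by (auto simp: cantor_def)

lemma subsequence_in_words [simp]: "\<omega> \<in> cantor n \<Longrightarrow> subsequence \<omega> i j \<in> words n"
  by (auto simp: cantor_def words_def)

lemma cantor_nonempty: "n > 0 \<Longrightarrow> (\<lambda>_. 0) \<in> cantor n"
  by (simp add: cantor_def)

lemma mem_cylinder: "\<omega> \<in> cylinder n u \<longleftrightarrow> (\<exists>\<eta> \<in> cantor n. \<omega> = u \<frown> \<eta>)"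
  by (auto simp: cylinder_def)

lemma conc_eq_conc_le:
  assumes "u \<frown> \<omega> = v \<frown> \<eta>" "length u \<le> length v"
  obtains z where "v = u @ z" "\<omega> = z \<frown> \<eta>"
proof -
  have "v = u @ drop (length u) v" 
    using arg_cong[OF assms(1), of "\<lambda>x. subsequence x 0 (length u)"] assms(2)
    by (metis append_take_drop_id prefix_conc_fst prefix_conc_length)
  moreover from this have "u \<frown> \<omega> = u \<frown> (drop (length u) v \<frown> \<eta>)"
    using assms(1) by (metis conc_conc)
  ultimately show ?thesis
    using that[of "drop (length u) v"] by (simp only: same_concat_eq)
qed

lemma conc_eq_conc_prefix:
  "u \<frown> \<omega> = v \<frown> \<eta> \<Longrightarrow> Sublist.prefix u v \<or> Sublist.prefix v u"
  by (metis conc_eq_conc_le nle_le prefixI)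

text \<open>Compactness of \<^term>\<open>cantor n\<close>: if no length works for a word, none works for one of its
  one-letter extensions, which would produce an infinite word without a prefix in \<open>P\<close>.\<close>

lemma bar_bounded:
  assumes "\<And>\<omega>. \<omega> \<in> cantor n \<Longrightarrow> \<exists>k. P (subsequence \<omega> 0 k)"
  shows "\<exists>K. \<forall>w \<in> words n. length w \<ge> K \<longrightarrow> (\<exists>u. Sublist.prefix u w \<and> P u)"
proof (rule ccontr)
  define bad where "bad w \<longleftrightarrow> w \<in> words n \<and>
    \<not> (\<exists>K. \<forall>z \<in> words n. length z \<ge> K \<longrightarrow> (\<exists>u. Sublist.prefix u (w @ z) \<and> P u))" for w
  assume "\<not> ?thesis"
  then have bad0: "bad []"
    by (simp add: bad_def)
  have ext: "\<exists>i < n. bad (w @ [i])" if w: "bad w" for w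
  proof (rule ccontr)
    assume "\<not> ?thesis"
    then have "\<forall>i < n. \<exists>K. \<forall>z \<in> words n. length z \<ge> K \<longrightarrow>
        (\<exists>u. Sublist.prefix u (w @ [i] @ z) \<and> P u)"
      using w by (auto simp: bad_def)
    then obtain K where K: "\<And>i z. \<lbrakk>i < n; z \<in> words n; length z \<ge> K i\<rbrakk> \<Longrightarrow>
        \<exists>u. Sublist.prefix u (w @ [i] @ z) \<and> P u"
      by metis
    \<comment> \<open>\<open>Suc\<close> makes every \<open>z\<close> of length at least
      \<open>M\<close> nonempty, and after its first letter \<open>i\<close> is removed at least
      \<open>K i\<close> letters remain.\<close>
    define M where "M = Suc (\<Sum>i<n. K i)"
    have "\<exists>u. Sublist.prefix u (w @ z) \<and> P u" if z: "z \<in> words n" "length z \<ge> M" for z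
    proof (cases z)
      case (Cons i z')
      then have i: "i < n" "z' \<in> words n" using z by auto
      have "K i \<le> (\<Sum>i<n. K i)"
        by (rule member_le_sum) (use i in auto)
      then have "length z' \<ge> K i"
        using z Cons by (auto simp: M_def)
      from K[OF i this] show ?thesis
        using Cons by auto
    qed (use z M_def in auto)
    then show False
      using w unfolding bad_def by blast
  qed
  obtain w where w: "\<And>k. bad (w k) \<and> length (w k) = k" "\<And>k. \<exists>i < n. w (Suc k) = w k @ [i]"
  proof -
    have "\<exists>w. \<forall>k. (bad (w k) \<and> length (w k) = k) \<and> (\<exists>i < n. w (Suc k) = w k @ [i])"
    proof (rule dependent_nat_choice)
      show "\<exists>y. (bad y \<and> length y = Suc k) \<and> (\<exists>i < n. y = x @ [i])"
        if "bad x \<and> length x = k" for x k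
        using ext[of x] that by auto
    qed (use bad0 in auto)
    then show ?thesis using that by auto
  qed
  obtain \<omega> where \<omega>: "\<And>k. \<omega> k < n \<and> w (Suc k) = w k @ [\<omega> k]"
    using w(2) by metis
  have "w k = subsequence \<omega> 0 k" for k
  proof (induction k)
    case 0
    then show ?case using w(1)[of 0] by simp
  next
    case (Suc k)
    then show ?case using \<omega>[of k] by simp
  qed
  moreover have "\<omega> \<in> cantor n"
    using \<omega> by (simp add: cantor_def)
  ultimately obtain k where k: "P (w k)"
    using assms by metis
  \<comment> \<open>All extensions of \<open>w k\<close> have the prefix \<open>w k\<close> in
    \<open>P\<close>, so the bound 0 shows that \<open>w k\<close> is not bad.\<close>
  then have "Sublist.prefix (w k) (w k @ z) \<and> P (w k)" for z
    by simp
  then show False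
    using w(1)[of k] unfolding bad_def by blast
qed

lemma finite_words_of_length_le: "finite {w \<in> words n. length w \<le> k}"
  using finite_lists_length_le[of "{..<n}" k] by (rule rev_finite_subset) (auto simp: words_def)

text \<open>If each prefix of \<open>\<omega>\<close> had an extension with wrong output, these
  extensions would converge coordinatewise to \<open>\<omega>\<close>. Their images would converge
  too, and in a product of discrete factors this makes the first \<open>N\<close> letters eventually
  correct.\<close>

lemma continuous_on_cantor_prefix:
  fixes \<psi> :: "(nat \<Rightarrow> nat) \<Rightarrow> (nat \<Rightarrow> nat)"
  assumes "continuous_on (cantor n) \<psi>" "\<omega> \<in> cantor n"
  shows "\<exists>k. \<forall>\<eta> \<in> cantor n. subsequence (\<psi> (subsequence \<omega> 0 k \<frown> \<eta>)) 0 N = subsequence (\<psi> \<omega>) 0 N"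
proof (rule ccontr)
  assume "\<not> ?thesis"
  then obtain \<eta> where \<eta>: "\<And>k. \<eta> k \<in> cantor n"
      "\<And>k. subsequence (\<psi> (subsequence \<omega> 0 k \<frown> \<eta> k)) 0 N \<noteq> subsequence (\<psi> \<omega>) 0 N"
    by metis
  define \<xi> where "\<xi> k = subsequence \<omega> 0 k \<frown> \<eta> k" for k
  have "\<xi> k \<in> cantor n" for k
    using \<eta> assms(2) by (simp add: \<xi>_def)
  have "(\<xi> \<longlonglongrightarrow> \<omega>)"
  proof -
    have "(\<lambda>k. \<xi> k i) \<longlonglongrightarrow> \<omega> i" for i
    proof (rule tendsto_eventually)
      show "\<forall>\<^sub>F k in sequentially. \<xi> k i = \<omega> i"
        using eventually_gt_at_top[of i] by eventually_elim (simp add: \<xi>_def)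
    qed
    then have "limitin (product_topology (\<lambda>_. euclidean) UNIV) \<xi> \<omega> sequentially"
      by (simp add: limitin_componentwise)
    then show ?thesis
      by (simp add: euclidean_product_topology)
  qed
  then have "(\<lambda>k. \<psi> (\<xi> k)) \<longlonglongrightarrow> \<psi> \<omega>"
    using continuous_on_tendsto_compose[OF assms(1) _ assms(2), of \<xi> sequentially] \<open>\<And>k. \<xi> k \<in> cantor n\<close>
    by simp
  then have "limitin (product_topology (\<lambda>_. euclidean) UNIV) (\<lambda>k. \<psi> (\<xi> k)) (\<psi> \<omega>) sequentially"
    by (simp add: euclidean_product_topology)
  then have "\<forall>\<^sub>F k in sequentially. \<psi> (\<xi> k) i = \<psi> \<omega> i" for i
    unfolding limitin_componentwise limitin_canonical_iff tendsto_discrete by blast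
  then have "\<forall>\<^sub>F k in sequentially. \<forall>i \<in> {..<N}. \<psi> (\<xi> k) i = \<psi> \<omega> i"
    by (intro eventually_ball_finite) auto
  then obtain k where "\<forall>i \<in> {..<N}. \<psi> (\<xi> k) i = \<psi> \<omega> i"
    using eventually_happens'[OF sequentially_bot] by blast
  then have "subsequence (\<psi> (\<xi> k)) 0 N = subsequence (\<psi> \<omega>) 0 N"
    by (simp add: subsequence_def)
  then show False
    using \<eta>(2)[of k] by (simp add: \<xi>_def)
qed

section \<open>Tree diagrams from local branches\<close>

text \<open>Excluding the prefix case leaves a position where both words carry a letter and first
  differ; it decides the order whatever the tails are.\<close>

lemma lexordp_less_fun:
  assumes "ord_class.lexordp u v" "\<not> Sublist.prefix u v"
  shows "less_fun (u \<frown> \<omega>) (v \<frown> \<eta>)"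
proof -
  from assms obtain us a b u' v' where eq: "u = us @ a # u'" "v = us @ b # v'" and ab: "a < b"
    by (auto simp: lexordp_iff)
  show ?thesis
  proof (rule less_funI, intro exI conjI allI impI)
    show "(u \<frown> \<omega>) (length us) < (v \<frown> \<eta>) (length us)"
      using ab by (simp add: eq conc_def nth_append)
    show "(u \<frown> \<omega>) k = (v \<frown> \<eta>) k" if "k < length us" for k
      using that by (simp add: eq conc_def nth_append)
  qed
qed

lemma less_fun_linear: "less_fun f g \<or> f = g \<or> less_fun g f"
  for f g :: "nat \<Rightarrow> 'a :: linorder"
proof (cases "f = g")
  case False
  then have ex: "\<exists>i. f i \<noteq> g i" by blast
  define k where "k = (LEAST i. f i \<noteq> g i)"
  have "f k \<noteq> g k"
    unfolding k_def by (rule LeastI_ex[OF ex])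
  moreover have "\<forall>j < k. f j = g j"
    unfolding k_def by (blast dest: not_less_Least)
  ultimately show ?thesis
    unfolding less_fun_def by (metis linorder_neqE)
qed simp

lemma complete_prefix_codeI:
  assumes "n > 0" "set us \<subseteq> words n" "sorted_wrt ord_class.lexordp us"
    and anti: "\<And>u v. \<lbrakk>u \<in> set us; v \<in> set us; Sublist.prefix u v\<rbrakk> \<Longrightarrow> u = v"
    and cover: "\<And>\<omega>. \<omega> \<in> cantor n \<Longrightarrow> \<exists>u \<in> set us. \<omega> \<in> cylinder n u"
  shows "complete_prefix_code n us"
  unfolding complete_prefix_code_def
proof (intro conjI partition_onI)
  show "\<Union> (cylinder n ` set us) = cantor n"
    using cover assms(2) by (fastforce simp: mem_cylinder)
  show "disjnt p q" if "p \<in> cylinder n ` set us" "q \<in> cylinder n ` set us" "p \<noteq> q" for p q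
  proof -
    from that obtain u v
      where uv: "u \<in> set us" "v \<in> set us" "p = cylinder n u" "q = cylinder n v" "u \<noteq> v"
      by blast
    have False if "\<omega> \<in> p" "\<omega> \<in> q" for \<omega>
    proof -
      from that obtain \<eta> \<eta>' where "\<omega> = u \<frown> \<eta>" "\<omega> = v \<frown> \<eta>'"
        unfolding uv mem_cylinder by blast
      then have "Sublist.prefix u v \<or> Sublist.prefix v u"
        using conc_eq_conc_prefix[of u \<eta> v \<eta>'] by simp
      then show False
        using anti uv by blast
    qed
    then show ?thesis
      unfolding disjnt_iff by blast
  qed
  show "{} \<notin> cylinder n ` set us"
    using cantor_nonempty[OF assms(1)] by (auto simp: cylinder_def)
qed (use assms in \<open>auto simp: pairwise_def\<close>)

lemma complete_prefix_code_cover: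
  assumes "complete_prefix_code n us" "\<omega> \<in> cantor n"
  obtains i \<eta> where "i < length us" "\<eta> \<in> cantor n" "\<omega> = us ! i \<frown> \<eta>"
proof -
  have "\<omega> \<in> \<Union> (cylinder n ` set us)"
    using assms by (auto simp: complete_prefix_code_def partition_on_def)
  then show ?thesis
    using that by (auto simp: mem_cylinder in_set_conv_nth)
qed

text \<open>The minimal source words of \<open>P\<close> form the first code;
  \<open>bar_bounded\<close> bounds their length, so they are finitely many. Injectivity of
  \<open>f\<close> makes the chosen targets an antichain, monotonicity keeps their order, and
  surjectivity makes them cover.\<close>

lemma tree_diagram_from_branches:
  assumes "n > 0"
    and bij: "bij_betw f (cantor n) (cantor n)"
    and mono: "monotone_on (cantor n) less_fun less_fun f"
    and branch: "\<And>u v. P u v \<Longrightarrow>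
      u \<in> words n \<and> v \<in> words n \<and> (\<forall>\<omega> \<in> cantor n. f (u \<frown> \<omega>) = v \<frown> \<omega>)"
    and cover: "\<And>\<omega>. \<omega> \<in> cantor n \<Longrightarrow> \<exists>u v. P u v \<and> \<omega> \<in> cylinder n u"
  obtains us vs where "tree_diagram n us vs f" "\<And>i. i < length us \<Longrightarrow> P (us ! i) (vs ! i)"
proof -
  define D where "D u \<longleftrightarrow> (\<exists>v. P u v)" for u
  define S where "S = {u. D u \<and> (\<forall>u'. Sublist.strict_prefix u' u \<longrightarrow> \<not> D u')}"
  have "\<forall>u. \<exists>v. D u \<longrightarrow> P u v"
    by (auto simp: D_def)
  then obtain v where v: "\<And>u. D u \<Longrightarrow> P u (v u)"
    by metis
  have DW: "u \<in> words n" "v u \<in> words n" if "D u" for u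
    using v[OF that] branch by auto
  have fD: "f (u \<frown> \<omega>) = v u \<frown> \<omega>" if "D u" "\<omega> \<in> cantor n" for u \<omega>
    using v[OF that(1)] branch that(2) by blast
  have coverD: "\<exists>k. D (subsequence \<omega> 0 k)" if "\<omega> \<in> cantor n" for \<omega>
  proof -
    from cover[OF that] obtain u \<eta> where "D u" "\<omega> = u \<frown> \<eta>"
      by (auto simp: D_def mem_cylinder)
    then show ?thesis
      by (intro exI[of _ "length u"]) simp
  qed
  obtain K where K: "\<And>w. \<lbrakk>w \<in> words n; length w \<ge> K\<rbrakk> \<Longrightarrow> \<exists>u. Sublist.prefix u w \<and> D u"
    using bar_bounded[of n D] coverD by blast
  have "length u \<le> K" if "u \<in> S" for u
  proof (rule ccontr)
    assume *: "\<not> length u \<le> K"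
    have "u \<in> words n" using DW that by (auto simp: S_def)
    \<comment> \<open>A word of \<open>S\<close> longer than \<open>K\<close> has a word of
      \<open>D\<close> as a prefix of its first \<open>K\<close> letters, against
      minimality.\<close>
    then have "take K u \<in> words n"
      by (metis append_take_drop_id words_append)
    then obtain u' where u': "Sublist.prefix u' (take K u)" "D u'"
      using K[of "take K u"] * by auto
    then have "Sublist.prefix u' u" "u' \<noteq> u"
      using * take_is_prefix[of K u] prefix_order.trans prefix_length_le[OF u'(1)] by auto
    then show False
      using that u' by (auto simp: S_def)
  qed
  then have "S \<subseteq> {w \<in> words n. length w \<le> K}"
    using DW by (auto simp: S_def)
  then have "finite S"
    by (rule finite_subset) (rule finite_words_of_length_le)
  have coverS: "\<exists>u \<in> S. \<omega> \<in> cylinder n u" if \<omega>: "\<omega> \<in> cantor n" for \<omega>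
  proof -
    define k where "k = (LEAST k. D (subsequence \<omega> 0 k))"
    have k: "D (subsequence \<omega> 0 k)"
      unfolding k_def by (rule LeastI_ex[OF coverD[OF \<omega>]])
    have k_least: "\<not> D (subsequence \<omega> 0 j)" if "j < k" for j
      using that unfolding k_def by (rule not_less_Least)
    have "subsequence \<omega> 0 k \<in> S"
      unfolding S_def
    proof (intro CollectI conjI allI impI)
      fix u' assume u': "Sublist.strict_prefix u' (subsequence \<omega> 0 k)"
      then have "length u' < k"
        using prefix_length_less[OF u'] by simp
      moreover obtain z where z: "subsequence \<omega> 0 k = u' @ z"
        using u' by (auto elim: strict_prefixE')
      then have "u' = take (length u') (subsequence \<omega> 0 k)"
        by simp
      with calculation have "u' = subsequence \<omega> 0 (length u')"
        by simp
      ultimately show "\<not> D u'"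
        using k_least by metis
    qed (fact k)
    moreover have "\<omega> \<in> cylinder n (subsequence \<omega> 0 k)"
      unfolding mem_cylinder
      by (rule bexI[of _ "Omega_Words_Fun.suffix k \<omega>"]) (use \<omega> in auto)
    ultimately show ?thesis by blast
  qed
  have antiS: "u = u'" if "u \<in> S" "u' \<in> S" "Sublist.prefix u u'" for u u'
    using that prefix_order.le_imp_less_or_eq unfolding S_def by blast
  have anti_v: "u = u'" if S: "u \<in> S" "u' \<in> S" and pre: "Sublist.prefix (v u) (v u')" for u u'
  proof -
    have D: "D u" "D u'"
      using S by (auto simp: S_def)
    obtain z where z: "v u' = v u @ z"
      using pre by (auto simp: prefix_def)
    \<comment> \<open>The zero tail serves as a test point: with \<open>z\<close> inserted after
      \<open>u\<close>, both points have the same image, so they coincide and \<open>u\<close>,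
      \<open>u'\<close> are comparable in an antichain.\<close>
    define \<omega> :: "nat \<Rightarrow> nat" where "\<omega> = (\<lambda>_. 0)"
    have \<omega>: "\<omega> \<in> cantor n" "z \<in> words n"
      using cantor_nonempty[OF assms(1)] DW[OF D(2)] by (auto simp: \<omega>_def z)
    have "f (u \<frown> (z \<frown> \<omega>)) = f (u' \<frown> \<omega>)"
      using fD[OF D(1), of "z \<frown> \<omega>"] fD[OF D(2) \<omega>(1)] \<omega> by (simp add: z)
    then have "u \<frown> (z \<frown> \<omega>) = u' \<frown> \<omega>"
      using bij_betw_imp_inj_on[OF bij] \<omega> DW D by (auto dest: inj_onD)
    then show ?thesis
      using conc_eq_conc_prefix antiS S by metis
  qed
  have mono_v: "ord_class.lexordp (v u) (v u')" if S: "u \<in> S" "u' \<in> S" and less: "ord_class.lexordp u u'" for u u'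
  proof -
    have D: "D u" "D u'"
      using S by (auto simp: S_def)
    define \<omega> :: "nat \<Rightarrow> nat" where "\<omega> = (\<lambda>_. 0)"
    have \<omega>: "\<omega> \<in> cantor n"
      using cantor_nonempty[OF assms(1)] by (auto simp: \<omega>_def)
    have ne: "u \<noteq> u'"
      using less lexordp_irreflexive' by blast
    then have "\<not> Sublist.prefix u u'"
      using antiS S by blast
    from lexordp_less_fun[OF less this] have "less_fun (f (u \<frown> \<omega>)) (f (u' \<frown> \<omega>))"
      using mono \<omega> DW D by (auto simp: monotone_on_def)
    then have lt: "less_fun (v u \<frown> \<omega>) (v u' \<frown> \<omega>)"
      using fD D \<omega> by simp
    \<comment> \<open>Word order is linear, so it suffices to exclude the reverse order and
      equality. As the targets are an antichain, reversed words would give reversed points, against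
      \<open>lt\<close>.\<close>
    have "\<not> ord_class.lexordp (v u') (v u)"
      using lexordp_less_fun[of "v u'" "v u" \<omega> \<omega>] less_fun_asym[OF lt] anti_v[OF S(2,1)] ne by blast
    moreover have "v u \<noteq> v u'"
      using lt less_fun_irrefl by metis
    ultimately show ?thesis
      using lexordp_linear by blast
  qed
  define us where "us = sorted_list_of_set S"
  have set_us: "set us = S"
    using \<open>finite S\<close> by (simp add: us_def)
  \<comment> \<open>\<open>sorted_list_of_set\<close> sorts by the lexicographic instance of
    \<open><\<close> on lists, which is unfolded to \<open>lexordp\<close>.\<close>
  have sorted: "sorted_wrt ord_class.lexordp us"
    using strict_sorted_list_of_set[of S] 
    by (simp add: us_def list_less_def[abs_def] lexordp_conv_lexord[abs_def])
  have code_us: "complete_prefix_code n us"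
  proof (rule complete_prefix_codeI)
    show "set us \<subseteq> words n"
      using DW by (auto simp: set_us S_def)
  qed (use assms(1) sorted antiS coverS set_us in simp_all)
  have code_vs: "complete_prefix_code n (map v us)"
  proof (rule complete_prefix_codeI)
    show "sorted_wrt ord_class.lexordp (map v us)"
      unfolding sorted_wrt_map
      by (rule sorted_wrt_mono_rel[OF _ sorted]) (use mono_v in \<open>auto simp: set_us\<close>)
    show "\<exists>w \<in> set (map v us). \<omega> \<in> cylinder n w" if \<omega>: "\<omega> \<in> cantor n" for \<omega>
    proof -
      obtain \<eta> where \<eta>: "\<eta> \<in> cantor n" "\<omega> = f \<eta>"
        using bij \<omega> by (auto simp: bij_betw_def)
      from coverS[OF \<eta>(1)] obtain u \<xi> where "u \<in> S" "\<xi> \<in> cantor n" "\<eta> = u \<frown> \<xi>"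
        by (auto simp: mem_cylinder)
      moreover from this have "\<omega> = v u \<frown> \<xi>"
        using fD \<eta> by (auto simp: S_def)
      ultimately show ?thesis
        by (auto simp: mem_cylinder set_us)
    qed
    show "set (map v us) \<subseteq> words n"
      using DW by (auto simp: set_us S_def)
    show "w = w'" if "w \<in> set (map v us)" "w' \<in> set (map v us)" "Sublist.prefix w w'" for w w'
      using that anti_v by (force simp: set_us)
  qed (fact assms(1))
  show ?thesis
  proof
    have "us ! i \<in> S" if "i < length us" for i
      using that set_us nth_mem by blast
    then have D: "D (us ! i)" if "i < length us" for i
      using that by (auto simp: S_def)
    then show "tree_diagram n us (map v us) f"
      using code_us code_vs fD by (auto simp: tree_diagram_def)
    show "P (us ! i) (map v us ! i)" if "i < length us" for i
      using v D that by simp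
  qed
qed

section \<open>Greatest common prefixes and local actions\<close>

lemma common_prefix_comparable:
  assumes "common_prefix u S" "common_prefix v S" "\<alpha> \<in> S"
  shows "Sublist.prefix u v \<or> Sublist.prefix v u"
  using assms conc_eq_conc_prefix unfolding common_prefix_def by metis

lemma greatest_common_prefix_eqI:
  assumes "common_prefix w S" "\<And>v. common_prefix v S \<Longrightarrow> Sublist.prefix v w"
  shows "greatest_common_prefix S = w"
  unfolding greatest_common_prefix_def
  by (rule the_equality) (use assms prefix_order.antisym in blast)+

text \<open>Two distinct points bound the length of common prefixes, so a longest one exists. Common
  prefixes are all prefixes of one point, hence comparable, and the longest is the greatest.\<close>

lemma greatest_common_prefix_exists:
  assumes "\<alpha> \<in> S" "\<beta> \<in> S" "\<alpha> \<noteq> \<beta>"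
  obtains w where "common_prefix w S" "\<And>v. common_prefix v S \<Longrightarrow> Sublist.prefix v w"
proof -
  obtain k where k: "\<alpha> k \<noteq> \<beta> k"
    using assms(3) by blast
  have bound: "length v \<le> k" if "common_prefix v S" for v
  proof (rule ccontr)
    assume "\<not> length v \<le> k"
    moreover obtain \<alpha>' \<beta>' where "\<alpha> = v \<frown> \<alpha>'" "\<beta> = v \<frown> \<beta>'"
      using \<open>common_prefix v S\<close> assms(1,2) unfolding common_prefix_def by blast
    ultimately show False
      using k by simp
  qed
  have "common_prefix [] S"
    by (simp add: common_prefix_def)
  then obtain w where w: "common_prefix w S" "\<forall>v. common_prefix v S \<longrightarrow> length v \<le> length w"
    using ex_has_greatest_nat[of "\<lambda>v. common_prefix v S" "[]" length "Suc k"] bound by (auto simp: less_Suc_eq_le)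
  show ?thesis
  proof (rule that[OF w(1)])
    show "Sublist.prefix v w" if v: "common_prefix v S" for v
      using common_prefix_comparable[OF v w(1) assms(1)] w(2) v
      by (metis not_equal_is_parallel parallelE prefix_length_le le_antisym prefix_order.refl)
  qed
qed

lemma common_prefix_greatest:
  assumes "\<alpha> \<in> S" "\<beta> \<in> S" "\<alpha> \<noteq> \<beta>"
  shows "common_prefix (greatest_common_prefix S) S"
  using greatest_common_prefix_exists[OF assms] greatest_common_prefix_eqI by metis

lemma prefix_greatest_common_prefix:
  assumes "\<alpha> \<in> S" "\<beta> \<in> S" "\<alpha> \<noteq> \<beta>" "common_prefix v S"
  shows "Sublist.prefix v (greatest_common_prefix S)"
  using greatest_common_prefix_exists[OF assms(1-3)] greatest_common_prefix_eqI assms(4) by metis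

lemma common_prefix_append_iff:
  "common_prefix (w @ v) ((\<lambda>\<omega>. w \<frown> \<omega>) ` S) \<longleftrightarrow> common_prefix v S"
  unfolding common_prefix_def by (simp flip: conc_conc)

text \<open>A common prefix of the shifted set is comparable with \<open>w\<close>: it is a prefix
  of \<open>w\<close>, or it extends \<open>w\<close> by a common prefix of
  \<open>S\<close>.\<close>

lemma greatest_common_prefix_conc:
  assumes "\<alpha> \<in> S" "\<beta> \<in> S" "\<alpha> \<noteq> \<beta>"
  shows "greatest_common_prefix ((\<lambda>\<omega>. w \<frown> \<omega>) ` S) = w @ greatest_common_prefix S"
proof (rule greatest_common_prefix_eqI)
  let ?S = "(\<lambda>\<omega>. w \<frown> \<omega>) ` S"
  show "common_prefix (w @ greatest_common_prefix S) ?S"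
    unfolding common_prefix_append_iff by (rule common_prefix_greatest[OF assms])
  fix v assume v: "common_prefix v ?S"
  have w: "common_prefix w ?S"
    by (auto simp: common_prefix_def)
  have "w \<frown> \<alpha> \<in> ?S"
    using assms(1) by blast
  from common_prefix_comparable[OF v w this] show "Sublist.prefix v (w @ greatest_common_prefix S)"
  proof
    assume "Sublist.prefix w v"
    then obtain v' where v': "v = w @ v'"
      by (auto simp: prefix_def)
    then have "Sublist.prefix v' (greatest_common_prefix S)"
      using v prefix_greatest_common_prefix[OF assms] by (simp add: common_prefix_append_iff)
    then show ?thesis
      by (simp add: v')
  qed simp
qed

section \<open>Composition rules for output prefixes and local actions\<close>

locale cantor_map =
  fixes n m :: nat and f :: "(nat \<Rightarrow> nat) \<Rightarrow> (nat \<Rightarrow> nat)"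
  assumes n2: "n \<ge> 2"
    and inj: "inj_on f (cantor n)"
    and maps: "\<omega> \<in> cantor n \<Longrightarrow> f \<omega> \<in> cantor m"
begin

text \<open>Guarantees that \<open>theta\<close> is meaningful, since a set with two distinct points
  has a greatest common prefix. Two constant tails exist because \<open>n \<ge> 2\<close>, and
  injectivity separates their images.\<close>

lemma two_points:
  assumes "u \<in> words n"
  obtains \<alpha> \<beta> where "\<alpha> \<in> f ` cylinder n u" "\<beta> \<in> f ` cylinder n u" "\<alpha> \<noteq> \<beta>"
proof -
  have c: "(\<lambda>_. 0) \<in> cantor n" "(\<lambda>_. 1) \<in> cantor n"
    using n2 by (auto simp: cantor_def)
  have "(\<lambda>_ :: nat. 0 :: nat) \<noteq> (\<lambda>_. 1)"
    by (simp add: fun_eq_iff)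
  then have "f (u \<frown> (\<lambda>_. 0)) \<noteq> f (u \<frown> (\<lambda>_. 1))"
    using inj_on_eq_iff[OF inj] assms c by simp
  then show ?thesis
    using that c unfolding cylinder_def by blast
qed

lemma conc_theta:
  assumes "u \<in> words n" "\<omega> \<in> cantor n"
  shows "f (u \<frown> \<omega>) = theta n f u \<frown> local_action n f u \<omega>"
proof -
  obtain \<alpha> \<beta> where "\<alpha> \<in> f ` cylinder n u" "\<beta> \<in> f ` cylinder n u" "\<alpha> \<noteq> \<beta>"
    using two_points[OF assms(1)] .
  from common_prefix_greatest[OF this] have "common_prefix (theta n f u) (f ` cylinder n u)"
    by (simp add: theta_def)
  moreover have "f (u \<frown> \<omega>) \<in> f ` cylinder n u"
    using assms by (auto simp: cylinder_def)
  ultimately obtain \<omega>' where "f (u \<frown> \<omega>) = theta n f u \<frown> \<omega>'"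
    unfolding common_prefix_def by blast
  then show ?thesis
    using assms by (simp add: local_action_def)
qed

lemma prefix_theta:
  assumes "u \<in> words n" "\<And>\<omega>. \<omega> \<in> cantor n \<Longrightarrow> \<exists>\<omega>'. f (u \<frown> \<omega>) = w \<frown> \<omega>'"
  shows "Sublist.prefix w (theta n f u)"
proof -
  obtain \<alpha> \<beta> where "\<alpha> \<in> f ` cylinder n u" "\<beta> \<in> f ` cylinder n u" "\<alpha> \<noteq> \<beta>"
    using two_points[OF assms(1)] .
  then show ?thesis
    unfolding theta_def
    by (rule prefix_greatest_common_prefix) (use assms(2) in \<open>auto simp: common_prefix_def cylinder_def\<close>)
qed

lemma theta_in_words: "u \<in> words n \<Longrightarrow> theta n f u \<in> words m"
  and local_action_in_cantor:
    "u \<in> words n \<Longrightarrow> \<omega> \<in> cantor n \<Longrightarrow> local_action n f u \<omega> \<in> cantor m"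
proof -
  have "theta n f u \<in> words m \<and> local_action n f u \<omega> \<in> cantor m"
    if "u \<in> words n" "\<omega> \<in> cantor n" for \<omega>
    using maps[of "u \<frown> \<omega>"] that by (simp add: conc_theta)
  then show "u \<in> words n \<Longrightarrow> theta n f u \<in> words m"
    and "u \<in> words n \<Longrightarrow> \<omega> \<in> cantor n \<Longrightarrow> local_action n f u \<omega> \<in> cantor m"
    using cantor_nonempty[of n] n2 by auto
qed

text \<open>Removing the common prefix preserves injectivity. The results of this locale can
  therefore be applied to local actions in turn.\<close>

lemma cantor_map_local_action:
  assumes "u \<in> words n"
  shows "cantor_map n m (local_action n f u)"
proof
  show "inj_on (local_action n f u) (cantor n)"
  proof (rule inj_onI)
    fix \<omega> \<eta> assume *: "\<omega> \<in> cantor n" "\<eta> \<in> cantor n" "local_action n f u \<omega> = local_action n f u \<eta>"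
    then have "f (u \<frown> \<omega>) = f (u \<frown> \<eta>)"
      using assms by (simp add: conc_theta)
    then have "u \<frown> \<omega> = u \<frown> \<eta>"
      using inj_onD[OF inj, of "u \<frown> \<omega>" "u \<frown> \<eta>"] * assms by simp
    then show "\<omega> = \<eta>" by simp
  qed
qed (use n2 local_action_in_cantor assms in auto)

text \<open>The image of the cylinder of \<open>u @ v\<close> under \<open>f\<close> is that of the
  cylinder of \<open>v\<close> under the local action, with \<open>theta n f u\<close> in
  front.\<close>

lemma theta_append:
  assumes "u \<in> words n" "v \<in> words n"
  shows "theta n f (u @ v) = theta n f u @ theta n (local_action n f u) v"
proof -
  interpret L: cantor_map n m "local_action n f u"
    by (rule cantor_map_local_action[OF assms(1)])
  obtain \<alpha> \<beta> where *: "\<alpha> \<in> local_action n f u ` cylinder n v"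
      "\<beta> \<in> local_action n f u ` cylinder n v" "\<alpha> \<noteq> \<beta>"
    using L.two_points[OF assms(2)] .
  have "f ((u @ v) \<frown> \<omega>) = theta n f u \<frown> local_action n f u (v \<frown> \<omega>)" if "\<omega> \<in> cantor n" for \<omega>
    using conc_theta[of u "v \<frown> \<omega>"] assms that by simp
  then have "f ` cylinder n (u @ v) = (\<lambda>\<omega>. theta n f u \<frown> \<omega>) ` (local_action n f u ` cylinder n v)"
    unfolding cylinder_def image_image by (intro image_cong refl)
  then show ?thesis
    using greatest_common_prefix_conc[OF *, of "theta n f u"] by (simp add: theta_def)
qed

text \<open>Both sides arise from the same value of \<open>f\<close> by cancelling the same prefix,
  by \<open>theta_append\<close>. Hence the transducer reading a word letter by letter passes
  through the local actions at its prefixes.\<close>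

lemma local_action_append:
  assumes "u \<in> words n" "v \<in> words n"
  shows "local_action n (local_action n f u) v = local_action n f (u @ v)"
proof -
  interpret L: cantor_map n m "local_action n f u"
    by (rule cantor_map_local_action[OF assms(1)])
  have "local_action n (local_action n f u) v \<omega> = local_action n f (u @ v) \<omega>"
    if \<omega>: "\<omega> \<in> cantor n" for \<omega>
  proof -
    have "theta n f (u @ v) \<frown> local_action n f (u @ v) \<omega> = f (u \<frown> (v \<frown> \<omega>))"
      using conc_theta[of "u @ v" \<omega>] assms \<omega> by simp
    also have "\<dots> = theta n f u \<frown> (theta n (local_action n f u) v \<frown> local_action n (local_action n f u) v \<omega>)"
      using conc_theta[of u "v \<frown> \<omega>"] L.conc_theta[of v \<omega>] assms \<omega> by simp
    finally show ?thesis
      using assms by (simp add: theta_append)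
  qed
  \<comment> \<open>States are compared as functions on the whole type; off \<open>cantor n\<close>
    both are \<open>undefined\<close> by \<open>restrict\<close>.\<close>
  moreover have "local_action n g w \<omega> = undefined" if "\<omega> \<notin> cantor n" for g w \<omega>
    using that by (simp add: local_action_def)
  ultimately show ?thesis
    by (metis ext)
qed

text \<open>The image of a local action has an empty greatest common prefix, so it determines \<open>y\<close>.\<close>

lemma local_action_eqI:
  assumes "u \<in> words n" "v \<in> words n"
    and eq: "\<And>\<omega>. \<omega> \<in> cantor n \<Longrightarrow> f (v \<frown> \<omega>) = y \<frown> local_action n f u \<omega>"
  shows "theta n f v = y" "local_action n f v = local_action n f u"
proof -
  interpret L: cantor_map n m "local_action n f u"
    by (rule cantor_map_local_action[OF assms(1)])
  obtain \<alpha> \<beta> where *: "\<alpha> \<in> local_action n f u ` cylinder n []"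
      "\<beta> \<in> local_action n f u ` cylinder n []" "\<alpha> \<noteq> \<beta>"
    using L.two_points[of "[]"] by auto
  have "f ` cylinder n v = (\<lambda>\<omega>. y \<frown> \<omega>) ` (local_action n f u ` cylinder n [])"
    unfolding cylinder_def image_image by (intro image_cong refl) (simp add: eq)
  then have "theta n f v = y @ theta n (local_action n f u) []"
    using greatest_common_prefix_conc[OF *, of y] by (simp add: theta_def)
  \<comment> \<open>Writing \<open>u\<close> as \<open>u @ []\<close> shows that nothing is left to
    factor out of a local action.\<close>
  moreover have "theta n (local_action n f u) [] = []"
    using theta_append[OF assms(1), of "[]"] by simp
  ultimately show \<theta>: "theta n f v = y"
    by simp
  show "local_action n f v = local_action n f u"
  proof
    fix \<omega> show "local_action n f v \<omega> = local_action n f u \<omega>"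
    proof (cases "\<omega> \<in> cantor n")
      case True
      then show ?thesis
        using conc_theta[OF assms(2) True] eq[OF True] by (simp add: \<theta>)
    qed (simp add: local_action_def)
  qed
qed

end

section \<open>The states of the forward automaton\<close>

lemma run_full:
  assumes "full_tree_automaton n A" "q \<in> states A" "u \<in> words n"
  obtains q' where "run A q u = Some q'" "q' \<in> states A"
  using assms(2,3)
proof (induction u arbitrary: q thesis)
  case (Cons i u)
  have "delta A (q, i) \<noteq> None"
    using assms(1) Cons.prems(2,3) by (simp add: full_tree_automaton_def)
  then obtain q' where q': "delta A (q, i) = Some q'"
    by blast
  then have "q' \<in> states A"
    using assms(1) by (auto simp: full_tree_automaton_def tree_automaton_def ran_def)
  then show ?case
    using Cons q' by auto
qed auto

locale forward = cantor_map n m \<psi> for n m :: nat and \<psi> +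
  fixes A :: "'q automaton"
  assumes m2: "m \<ge> 2"
    and surj: "\<psi> ` cantor n = cantor m"
    and full: "full_tree_automaton n A"
begin

abbreviation T where "T \<equiv> minimal_transducer n \<psi>"
abbreviation \<theta> where "\<theta> \<equiv> theta n \<psi>"
abbreviation start where "start \<equiv> (tstart T, root A)"
abbreviation edge where "edge \<equiv> labelled_edge n T A"
abbreviation R where "R \<equiv> reach_set n T A"

text \<open>\<open>p\<close> is the vertex of the product graph reached on input \<open>u\<close>.
  Several inputs may share a vertex; such inputs are the ones that get exchanged below.\<close>

definition node where
  "node u p \<longleftrightarrow> u \<in> words n \<and> fst p = local_action n \<psi> u \<and> run A (root A) u = Some (snd p)"

lemma root_in_states: "root A \<in> states A"
  using full by (simp add: full_tree_automaton_def tree_automaton_def)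

lemma ex_node: "u \<in> words n \<Longrightarrow> \<exists>p. node u p"
  using run_full[OF full root_in_states] by (auto simp: node_def)

text \<open>By surjectivity the constant words 0 and 1 are both values of \<open>\<psi>\<close>, so
  no first letter is common to all values.\<close>

lemma theta_Nil: "\<theta> [] = []"
proof (cases "\<theta> []")
  case (Cons b w)
  define c :: nat where "c = (if b = 0 then 1 else 0)"
  have "(\<lambda>_. c) \<in> cantor m"
    using m2 by (simp add: cantor_def c_def)
  then obtain \<omega> where "\<omega> \<in> cantor n" "\<psi> \<omega> = (\<lambda>_. c)"
    using surj by (metis imageE)
  then have "(\<lambda>_. c) = (b # w) \<frown> local_action n \<psi> [] \<omega>"
    using conc_theta[of "[]" \<omega>] Cons by simp
  then have "c = b"
    by (metis build.simps(1) build_cons)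
  then show ?thesis
    by (simp add: c_def split: if_splits)
qed

lemma local_action_Nil: "local_action n \<psi> [] = tstart T"
  by (auto simp: local_action_def theta_Nil minimal_transducer_def)

lemma node_start: "node [] start"
  by (simp add: node_def local_action_Nil)

lemma toutput_node:
  assumes "node u p" "i < n"
  shows "\<theta> (u @ [i]) = \<theta> u @ toutput T (fst p) i"
  using assms theta_append[of u "[i]"] by (simp add: node_def minimal_transducer_def)

lemma product_edge_node:
  assumes "node u p" "product_edge n T A p i p'"
  shows "node (u @ [i]) p'"
  using assms local_action_append[of u "[i]"]
  by (auto simp: node_def product_edge_def minimal_transducer_def run_append)

lemma node_product_edge:
  assumes "node u p" "node (u @ [i]) p'"
  shows "product_edge n T A p i p'"
proof -
  have u: "u \<in> words n" "i < n"
    using assms by (auto simp: node_def)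
  have "snd p \<in> states A"
    using run_full[OF full root_in_states u(1)] assms(1) by (auto simp: node_def)
  then show ?thesis
    using assms u local_action_append[of u "[i]"]
    by (cases p) (auto simp: node_def product_edge_def minimal_transducer_def run_append
        split: Option.bind_splits)
qed

lemma node_reachable: "node u p \<Longrightarrow> reachable n T A p"
proof (induction u arbitrary: p rule: rev_induct)
  case Nil
  then have "p = start"
    using node_start by (auto simp: node_def intro: prod_eqI)
  then show ?case
    by (simp add: reachable_def)
next
  case (snoc i u)
  then have "u \<in> words n"
    by (simp add: node_def)
  then obtain p' where p': "node u p'"
    using ex_node by blast
  with node_product_edge[OF p' snoc.prems] snoc.IH[OF p'] show ?case
    unfolding reachable_def by (blast intro: rtranclp.rtrancl_into_rtrancl)
qed

section \<open>Paths in the subdivided graph and membership in the sets R_x\<close>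

lemma subdivided_path:
  assumes "reachable n T A p" "product_edge n T A p i p'" "j < length (toutput T (fst p) i)"
  shows "labelled_path edge (Old p) (take j (toutput T (fst p) i)) (if j = 0 then Old p else Inner p i j)"
  using assms(3)
proof (induction j)
  case 0
  then show ?case by (simp add: path_nil)
next
  case (Suc j)
  let ?w = "toutput T (fst p) i"
  have "edge (if j = 0 then Old p else Inner p i j) [?w ! j]
      (if Suc j = length ?w then Old p' else Inner p i (Suc j))"
    by (rule subdivided[OF assms(1,2) refl]) (use Suc.prems in auto)
  from path_step[OF Suc.IH this] show ?case
    using Suc.prems by (simp add: take_Suc_conv_app_nth)
qed

lemma edge_path:
  assumes "reachable n T A p" "product_edge n T A p i p'"
  shows "labelled_path edge (Old p) (toutput T (fst p) i) (Old p')"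
proof (cases "length (toutput T (fst p) i) \<le> 1")
  case True
  with kept[OF assms refl] show ?thesis
    using path_step[OF path_nil] by fastforce
next
  case False
  let ?w = "toutput T (fst p) i"
  \<comment> \<open>Index of the last unit edge of the subdivision, the one that returns to the old
    vertex \<open>p'\<close>.\<close>
  define j where "j = length ?w - 1"
  have j: "j < length ?w" "Suc j = length ?w"
    using False by (auto simp: j_def)
  have "edge (if j = 0 then Old p else Inner p i j) [?w ! j] (Old p')"
    using subdivided[OF assms refl _ j(1)] False unfolding if_P[OF j(2)] by simp
  from path_step[OF subdivided_path[OF assms j(1)] this]
  have "labelled_path edge (Old p) (take j ?w @ [?w ! j]) (Old p')" .
  moreover have "take j ?w @ [?w ! j] = ?w"
    using take_Suc_conv_app_nth[OF j(1)] by (simp only: j(2) take_all order_refl)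
  ultimately show ?thesis
    by (simp only:)
qed

lemma node_path: "node u p \<Longrightarrow> labelled_path edge (Old start) (\<theta> u) (Old p)"
proof (induction u arbitrary: p rule: rev_induct)
  case Nil
  then have "p = start"
    using node_start by (auto simp: node_def intro: prod_eqI)
  then show ?case
    by (simp add: theta_Nil path_nil)
next
  case (snoc i u)
  then have u: "u \<in> words n" "i < n"
    by (auto simp: node_def)
  then obtain p' where p': "node u p'"
    using ex_node by blast
  have "labelled_path edge (Old p') (toutput T (fst p') i) (Old p)"
    by (rule edge_path[OF node_reachable[OF p'] node_product_edge[OF p' snoc.prems]])
  from labelled_path_trans[OF this snoc.IH[OF p']] show ?case
    using toutput_node[OF p' u(2)] by simp
qed

text \<open>Serves as the invariant of paths from the start vertex; \<open>reach_set_eq\<close>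
  shows that it describes R_x exactly.\<close>

definition located where
  "located x v \<longleftrightarrow> (case v of
     Old p \<Rightarrow> \<exists>u. node u p \<and> x = \<theta> u
   | Inner p i j \<Rightarrow> \<exists>u. node u p \<and> i < n \<and> 0 < j \<and> j < length (toutput T (fst p) i) \<and>
       x = \<theta> u @ take j (toutput T (fst p) i))"

text \<open>Paths grow at their end, so only the last edge has to be checked. The source is a
  variable \<open>a\<close> with an equation so that rule induction applies.\<close>

lemma path_located:
  assumes "labelled_path edge a x v" "a = Old start"
  shows "located x v"
  using assms
proof (induction rule: labelled_path.induct)
  case (path_nil v)
  then show ?case
    using node_start theta_Nil by (auto simp: located_def)
next
  case (path_step a x v y w)
  then have IH: "located x v" by simp
  from \<open>edge v y w\<close> show ?case
  proof cases
    case (kept p i p')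
    with IH obtain u where u: "node u p" "x = \<theta> u"
      by (auto simp: located_def)
    with kept have "i < n" "node (u @ [i]) p'"
      using product_edge_node by (auto simp: product_edge_def)
    with kept u toutput_node[OF u(1)] show ?thesis
      by (auto simp: located_def)
  next
    case (subdivided p i p' l j)
    have i: "i < n"
      using subdivided by (auto simp: product_edge_def)
    \<comment> \<open>For \<open>j = 0\<close> the edge leaves the old vertex and
      \<open>take j l\<close> is empty; otherwise this is the clause for inner vertices.\<close>
    obtain u where u: "node u p" "x = \<theta> u @ take j l"
      using IH subdivided by (cases "j = 0") (auto simp: located_def)
    have xy: "x @ y = \<theta> u @ take (Suc j) l"
      using u subdivided by (simp add: take_Suc_conv_app_nth)
    have "node (u @ [i]) p'"
      using product_edge_node[OF u(1)] subdivided by blast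
    then show ?thesis
      using xy u(1) i subdivided toutput_node[OF u(1) i] by (auto simp: located_def)
  qed
qed

lemma reach_set_eq: "R x = Collect (located x)"
proof (intro equalityI subsetI)
  fix v assume "v \<in> R x"
  then show "v \<in> Collect (located x)"
    using path_located by (simp add: reach_set_def)
next
  fix v assume v: "v \<in> Collect (located x)"
  show "v \<in> R x"
  proof (cases v)
    case (Old p)
    then obtain u where "node u p" "x = \<theta> u"
      using v by (auto simp: located_def)
    with node_path[of u p] show ?thesis
      by (simp add: Old reach_set_def)
  next
    case (Inner p i j)
    let ?w = "toutput T (fst p) i"
    obtain u where u: "node u p" "i < n" "0 < j" "j < length ?w" "x = \<theta> u @ take j ?w"
      using v Inner by (auto simp: located_def)
    then have "u @ [i] \<in> words n"
      by (simp add: node_def)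
    then obtain p' where "node (u @ [i]) p'"
      using ex_node by blast
    from subdivided_path[OF node_reachable[OF u(1)] node_product_edge[OF u(1) this] u(4)]
    have "labelled_path edge (Old p) (take j ?w) v"
      using u(3) Inner by simp
    from labelled_path_trans[OF this node_path[OF u(1)]] show ?thesis
      by (simp add: reach_set_def u(5))
  qed
qed

lemma Old_in_reach_set: "Old p \<in> R x \<longleftrightarrow> (\<exists>u. node u p \<and> x = \<theta> u)"
  by (simp add: reach_set_eq located_def)

lemma Inner_in_reach_set:
  "Inner p i j \<in> R x \<longleftrightarrow> (\<exists>u. node u p \<and> i < n \<and> 0 < j \<and> j < length (toutput T (fst p) i) \<and>
     x = \<theta> u @ take j (toutput T (fst p) i))"
  by (simp add: reach_set_eq located_def)

end

section \<open>Equality of states and conjugation\<close>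

locale forward_homeo = forward +
  assumes cont: "continuous_on (cantor n) \<psi>"
begin

lemma theta_take: "u \<in> words n \<Longrightarrow> Sublist.prefix w u \<Longrightarrow> length (\<theta> w) \<le> length (\<theta> u)"
  by (auto simp: prefix_def theta_append)

text \<open>By continuity a long prefix of \<open>\<omega>\<close> fixes the first \<open>N\<close>
  letters of the image, and these are a common prefix for the whole cylinder.\<close>

lemma theta_length_at_point:
  assumes "\<omega> \<in> cantor n"
  shows "\<exists>k. length (\<theta> (subsequence \<omega> 0 k)) \<ge> N"
proof -
  obtain k where k: "\<And>\<eta>. \<eta> \<in> cantor n \<Longrightarrow>
      subsequence (\<psi> (subsequence \<omega> 0 k \<frown> \<eta>)) 0 N = subsequence (\<psi> \<omega>) 0 N"
    using continuous_on_cantor_prefix[OF cont assms] by blast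
  have "Sublist.prefix (subsequence (\<psi> \<omega>) 0 N) (\<theta> (subsequence \<omega> 0 k))"
  proof (rule prefix_theta)
    show "\<exists>\<omega>'. \<psi> (subsequence \<omega> 0 k \<frown> \<eta>) = subsequence (\<psi> \<omega>) 0 N \<frown> \<omega>'" if "\<eta> \<in> cantor n" for \<eta>
      using prefix_suffix[of "\<psi> (subsequence \<omega> 0 k \<frown> \<eta>)" N] unfolding k[OF that] by blast
  qed (use assms in simp)
  then show ?thesis
    using prefix_length_le by fastforce
qed

text \<open>Compactness makes the pointwise bound uniform, and \<open>theta_take\<close> passes from
  a prefix to the whole word.\<close>

lemma theta_length_unbounded:
  obtains K where "\<And>w. \<lbrakk>w \<in> words n; length w \<ge> K\<rbrakk> \<Longrightarrow> length (\<theta> w) \<ge> N"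
proof -
  obtain K where K: "\<And>w. \<lbrakk>w \<in> words n; length w \<ge> K\<rbrakk> \<Longrightarrow>
      \<exists>u. Sublist.prefix u w \<and> length (\<theta> u) \<ge> N"
    using bar_bounded[of n "\<lambda>u. length (\<theta> u) \<ge> N"] theta_length_at_point by blast
  show ?thesis
    using that[of K] K theta_take order_trans by metis
qed

text \<open>Follow \<open>\<omega>\<close> until the output first covers \<open>x\<close>. Either it
  equals \<open>x\<close> and an old vertex lies in \<open>R x\<close>, or \<open>x\<close> ends
  inside the last edge label and an inner vertex does. An input placing this vertex in
  \<open>R y\<close> yields \<open>v\<close>; \<open>z\<close> is the overshoot beyond
  \<open>x\<close>.\<close>

lemma common_states_branch:
  assumes sub: "R x \<subseteq> R y" and \<omega>: "\<omega> \<in> cantor n" and x: "\<psi> \<omega> = x \<frown> \<xi>"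
  obtains u v z where "u \<in> words n" "v \<in> words n" "\<omega> \<in> cylinder n u"
    "run A (root A) u = run A (root A) v" "z \<in> words m"
    "\<And>\<eta>. \<eta> \<in> cantor n \<Longrightarrow> \<psi> (u \<frown> \<eta>) = (x @ z) \<frown> local_action n \<psi> u \<eta>"
    "\<And>\<eta>. \<eta> \<in> cantor n \<Longrightarrow> \<psi> (v \<frown> \<eta>) = (y @ z) \<frown> local_action n \<psi> u \<eta>"
proof -
  define w where "w k = subsequence \<omega> 0 k" for k
  have w: "w k \<in> words n" "\<omega> \<in> cylinder n (w k)" "w (Suc k) = w k @ [\<omega> k]" for k
  proof -
    show "\<omega> \<in> cylinder n (w k)"
      unfolding mem_cylinder w_def
      by (rule bexI[of _ "Omega_Words_Fun.suffix k \<omega>"]) (use \<omega> in auto)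
  qed (use \<omega> in \<open>auto simp: w_def\<close>)
  have pt: "\<exists>\<zeta>. x \<frown> \<xi> = \<theta> (w k) \<frown> \<zeta>" for k
  proof -
    obtain \<eta> where "\<eta> \<in> cantor n" "\<omega> = w k \<frown> \<eta>"
      using w(2)[of k] by (auto simp: mem_cylinder)
    then show ?thesis
      using conc_theta[OF w(1)] x by metis
  qed
  define k where "k = (LEAST k. length (\<theta> (w k)) \<ge> length x)"
  have k: "length (\<theta> (w k)) \<ge> length x"
    unfolding k_def w_def by (rule LeastI_ex) (rule theta_length_at_point[OF \<omega>])
  have k_least: "length (\<theta> (w j)) < length x" if "j < k" for j
    using not_less_Least[OF that[unfolded k_def]] by simp
  obtain z where z: "\<theta> (w k) = x @ z"
    using pt[of k] conc_eq_conc_le k by metis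
  have zm: "z \<in> words m"
    using theta_in_words[OF w(1), of k] by (simp add: z)
  have \<psi>k: "\<psi> (w k \<frown> \<eta>) = (x @ z) \<frown> local_action n \<psi> (w k) \<eta>" if "\<eta> \<in> cantor n" for \<eta>
    using conc_theta[OF w(1) that, of k] by (simp add: z)
  show ?thesis
  proof (cases "z = []")
    case True
    obtain p where p: "node (w k) p"
      using ex_node w(1) by blast
    have "x = \<theta> (w k)"
      using z True by simp
    with p have "Old p \<in> R x"
      unfolding Old_in_reach_set by blast
    then have "Old p \<in> R y"
      using sub by blast
    then obtain v where v: "node v p" "y = \<theta> v"
      unfolding Old_in_reach_set by blast
    have la: "local_action n \<psi> v = local_action n \<psi> (w k)"
      using p v by (simp add: node_def)
    show ?thesis
    proof (rule that[of "w k" v z])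
      show "\<psi> (v \<frown> \<eta>) = (y @ z) \<frown> local_action n \<psi> (w k) \<eta>" if "\<eta> \<in> cantor n" for \<eta>
        using conc_theta[of v \<eta>] that v True la by (simp add: node_def)
    qed (use p v w zm \<psi>k in \<open>auto simp: node_def\<close>)
  next
    case False
    \<comment> \<open>The empty word has empty output and cannot overshoot, so a last letter
      \<open>i\<close> was read.\<close>
    have "k \<noteq> 0"
    proof
      assume "k = 0"
      then show False
        using z theta_Nil False by (simp add: w_def)
    qed
    then obtain j where j: "k = Suc j"
      using not0_implies_Suc by blast
    define i where "i = \<omega> j"
    have i: "i < n"
      using \<omega> by (simp add: cantor_def i_def)
    have wk: "w k = w j @ [i]"
      by (simp add: j w(3) i_def)
    obtain p where p: "node (w j) p"
      using ex_node w(1) by blast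
    define l where "l = toutput T (fst p) i"
    have \<theta>k: "\<theta> (w k) = \<theta> (w j) @ l"
      using toutput_node[OF p i] by (simp add: wk l_def)
    \<comment> \<open>Minimality of \<open>k\<close> makes \<open>t\<close> nonempty. As
      \<open>z\<close> is nonempty too, cutting the label into \<open>t @ z\<close> happens at a
      genuine inner vertex.\<close>
    obtain t where t: "x = \<theta> (w j) @ t" "t \<noteq> []"
    proof -
      have "length (\<theta> (w j)) < length x"
        using k_least j by simp
      moreover from this obtain t where "x = \<theta> (w j) @ t"
        using pt[of j] conc_eq_conc_le[of "\<theta> (w j)" _ x \<xi>] by (metis less_imp_le)
      ultimately show ?thesis
        using that by auto
    qed
    have l: "l = t @ z"
      using \<theta>k z t by simp
    have t_l: "0 < length t" "length t < length l" "take (length t) l = t"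
      using t(2) False by (simp_all add: l)
    then have "Inner p i (length t) \<in> R x"
      unfolding Inner_in_reach_set l_def[symmetric] using p i t(1) by (intro exI[of _ "w j"]) simp
    then have "Inner p i (length t) \<in> R y"
      using sub by blast
    then obtain v where v: "node v p" "y = \<theta> v @ t"
      unfolding Inner_in_reach_set l_def[symmetric] t_l by blast
    obtain p' where p': "node (w k) p'"
      using ex_node w(1) by blast
    \<comment> \<open>From the shared vertex \<open>p\<close> the letter \<open>i\<close> leads to
      the same target, and the rest \<open>z\<close> of the label is output after
      \<open>y\<close>.\<close>
    have v': "node (v @ [i]) p'"
      using product_edge_node[OF v(1)] node_product_edge[OF p] p' wk by auto
    have \<theta>v: "\<theta> (v @ [i]) = y @ z"
      using toutput_node[OF v(1) i] by (simp add: v l flip: l_def)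
    have la: "local_action n \<psi> (v @ [i]) = local_action n \<psi> (w k)"
      using p' v' by (simp add: node_def)
    show ?thesis
    proof (rule that[of "w k" "v @ [i]" z])
      show "\<psi> ((v @ [i]) \<frown> \<eta>) = (y @ z) \<frown> local_action n \<psi> (w k) \<eta>" if "\<eta> \<in> cantor n" for \<eta>
        using conc_theta[of "v @ [i]" \<eta>] that v' la \<theta>v unfolding node_def by metis
    qed (use p' v' w zm \<psi>k in \<open>auto simp: node_def\<close>)
  qed
qed

text \<open>The assumption holds for all but finitely many words \<open>w\<close>. The vertices at and on the edges out
  of the exceptional ones lie at bounded depth, so they do not contribute to \<open>R (x @ z)\<close> for long
  \<open>z\<close>.\<close>

lemma reach_set_mono:
  assumes fK: "\<And>w. \<lbrakk>w \<in> words n; length w \<ge> K\<rbrakk> \<Longrightarrow>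
    \<exists>w' \<in> words n. run A (root A) w' = run A (root A) w \<and>
      (\<forall>\<eta> \<in> cantor n. \<psi> (w' \<frown> \<eta>) = f (\<psi> (w \<frown> \<eta>)))"
  obtains N where "\<And>x y z. \<lbrakk>length x \<le> L; \<forall>\<xi> \<in> cantor m. f (x \<frown> \<xi>) = y \<frown> \<xi>;
      z \<in> words m; length z \<ge> N\<rbrakk> \<Longrightarrow> R (x @ z) \<subseteq> R (y @ z)"
proof -
  obtain K' where K': "\<And>w. \<lbrakk>w \<in> words n; length w \<ge> K'\<rbrakk> \<Longrightarrow> length (\<theta> w) \<ge> L"
    using theta_length_unbounded[of L] by blast
  \<comment> \<open>\<open>K\<close> secures a partner word, and \<open>K'\<close> makes the output
    long enough to contain \<open>x\<close>.\<close>
  define M where "M = max K K'"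
  define B where "B = (\<lambda>w. length (\<theta> w)) ` {w \<in> words n. length w \<le> M}"
  have "finite B"
    unfolding B_def by (intro finite_imageI finite_words_of_length_le)
  \<comment> \<open>Exceeds every output of words of length at most \<open>M\<close>, so an output
    of length \<open>N\<close> or more forces a longer input.\<close>
  define N where "N = Suc (Max (insert 0 B))"
  have short: "length (\<theta> w) < N" if "w \<in> words n" "length w \<le> M" for w
    using that \<open>finite B\<close> by (auto simp: N_def B_def less_Suc_eq_le intro!: Max_ge)
  show ?thesis
  proof (rule that)
    fix x y z
    assume x: "length x \<le> L" and fx: "\<forall>\<xi> \<in> cantor m. f (x \<frown> \<xi>) = y \<frown> \<xi>"
      and z: "z \<in> words m" "length z \<ge> N"
    \<comment> \<open>\<open>t\<close> is the part read on an edge out of \<open>p\<close>, empty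
      for old vertices. As \<open>\<theta> u\<close> contains \<open>x\<close>, \<open>f\<close>
      just replaces this \<open>x\<close> by \<open>y\<close>, and \<open>local_action_eqI\<close>
      identifies output and state of the partner \<open>u'\<close>.\<close>
    have key: "\<exists>u'. node u' p \<and> y @ z = \<theta> u' @ t"
      if u: "node u p" "length u \<ge> M" and t: "x @ z = \<theta> u @ t" for u p t
    proof -
      have uw: "u \<in> words n"
        using u(1) by (simp add: node_def)
      have "length x \<le> length (\<theta> u)"
        using K'[OF uw] u(2) x by (simp add: M_def)
      with t have "\<exists>z'. \<theta> u = x @ z' \<and> z = z' @ t"
        by (auto simp: append_eq_append_conv2)
      then obtain z' where z': "\<theta> u = x @ z'" "z = z' @ t"
        by blast
      obtain u' where u': "u' \<in> words n" "run A (root A) u' = run A (root A) u"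
          "\<forall>\<eta> \<in> cantor n. \<psi> (u' \<frown> \<eta>) = f (\<psi> (u \<frown> \<eta>))"
        using fK[OF uw] u(2) by (auto simp: M_def)
      have "\<psi> (u' \<frown> \<eta>) = (y @ z') \<frown> local_action n \<psi> u \<eta>" if "\<eta> \<in> cantor n" for \<eta>
      proof -
        have "z' \<frown> local_action n \<psi> u \<eta> \<in> cantor m"
          using z z' local_action_in_cantor[OF uw that] by simp
        then have "f (x \<frown> (z' \<frown> local_action n \<psi> u \<eta>)) = y \<frown> (z' \<frown> local_action n \<psi> u \<eta>)"
          using fx by blast
        then show ?thesis
          using u'(3) conc_theta[OF uw that] that z' by simp
      qed
      from local_action_eqI[OF uw u'(1) this]
      show ?thesis
        using u' u z' by (intro exI[of _ u']) (simp add: node_def)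
    qed
    show "R (x @ z) \<subseteq> R (y @ z)"
    proof
      fix v assume v: "v \<in> R (x @ z)"
      show "v \<in> R (y @ z)"
      proof (cases v)
        case (Old p)
        then obtain u where u: "node u p" "x @ z = \<theta> u"
          using v by (auto simp: Old_in_reach_set)
        have "length (\<theta> u) \<ge> N"
          using z arg_cong[OF u(2), of length] by simp
        then have "length u \<ge> M"
          using short[of u] u(1) by (force simp: node_def)
        then show ?thesis
          using key[of u p "[]"] u by (auto simp: Old Old_in_reach_set)
      next
        case (Inner p i j)
        let ?w = "toutput T (fst p) i"
        obtain u where u: "node u p" "i < n" "0 < j" "j < length ?w" "x @ z = \<theta> u @ take j ?w"
          using v by (auto simp: Inner Inner_in_reach_set)
        \<comment> \<open>Here \<open>\<theta> u\<close> itself may be short, so the bound is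
          applied to \<open>u @ [i]\<close>, whose output extends \<open>x @ z\<close>; this costs
          one letter of input.\<close>
        have "length (\<theta> (u @ [i])) \<ge> N"
          using z arg_cong[OF u(5), of length] u(4) toutput_node[OF u(1,2)] by simp
        then have "length (u @ [i]) > M"
          using short[of "u @ [i]"] u(1,2) by (force simp: node_def)
        then show ?thesis
          using key[of u p "take j ?w"] u by (auto simp: Inner Inner_in_reach_set)
      qed
    qed
  qed
qed

end

section \<open>The diagram groups\<close>

lemma homeomorphism_imp_bij_betw: "homeomorphism S T f g \<Longrightarrow> bij_betw f S T"
  by (rule bij_betw_byWitness[where f' = g]) (auto simp: homeomorphism_def)

text \<open>The diagram is selected from the given local exchanges, so each of its pairs has equal
  runs; fullness of \<open>A\<close> makes these runs defined.\<close>

lemma diagram_groupI: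
  assumes "n > 0" "f \<in> extensional (cantor n)" "homeomorphism (cantor n) (cantor n) f g"
    and "monotone_on (cantor n) less_fun less_fun f"
    and full: "full_tree_automaton n A"
    and branch: "\<And>\<omega>. \<omega> \<in> cantor n \<Longrightarrow> \<exists>u v. \<omega> \<in> cylinder n u \<and> u \<in> words n \<and> v \<in> words n \<and>
      (\<forall>\<eta> \<in> cantor n. f (u \<frown> \<eta>) = v \<frown> \<eta>) \<and> run A (root A) u = run A (root A) v"
  shows "f \<in> diagram_group n A"
proof -
  define P where "P u v \<longleftrightarrow> u \<in> words n \<and> v \<in> words n \<and>
      (\<forall>\<eta> \<in> cantor n. f (u \<frown> \<eta>) = v \<frown> \<eta>) \<and> run A (root A) u = run A (root A) v" for u v
  have "bij_betw f (cantor n) (cantor n)"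
    using homeomorphism_imp_bij_betw[OF assms(3)] .
  then obtain us vs where d: "tree_diagram n us vs f" "\<And>i. i < length us \<Longrightarrow> P (us ! i) (vs ! i)"
  proof (rule tree_diagram_from_branches[OF assms(1) _ assms(4), of P])
    show "\<exists>u v. P u v \<and> \<omega> \<in> cylinder n u" if "\<omega> \<in> cantor n" for \<omega>
      using branch[OF that] unfolding P_def by blast
  qed (auto simp: P_def)
  have "root A \<in> states A"
    using full by (simp add: full_tree_automaton_def tree_automaton_def)
  then have "accepted A us vs"
    unfolding accepted_def using d(2) run_full[OF full] P_def by (metis option.distinct(1))
  then show ?thesis
    using assms d(1) unfolding diagram_group_def thompson_F_def by blast
qed

text \<open>Continued by zeros, \<open>w\<close> lies in the cylinder of some code word. The sum of
  lengths bounds each of them, so this code word ends within \<open>w\<close>.\<close>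

lemma complete_prefix_code_long_word:
  assumes "complete_prefix_code n us" "n > 0" "w \<in> words n" "length w \<ge> sum_list (map length us)"
  obtains i z where "i < length us" "z \<in> words n" "w = us ! i @ z"
proof -
  have "w \<frown> (\<lambda>_. 0) \<in> cantor n"
    using assms(2,3) cantor_nonempty by simp
  then obtain i \<eta> where i: "i < length us" "w \<frown> (\<lambda>_. 0) = us ! i \<frown> \<eta>"
    by (rule complete_prefix_code_cover[OF assms(1)])
  have "length (us ! i) \<le> sum_list (map length us)"
    using i(1) by (intro member_le_sum_list) auto
  then have "length (us ! i) \<le> length w"
    using assms(4) by simp
  then obtain z where "w = us ! i @ z"
    by (rule conc_eq_conc_le[OF i(2)[symmetric]])
  then show ?thesis
    using that[of i z] i(1) assms(3) by simp
qed

text \<open>Supplies the assumption of \<open>reach_set_mono\<close>. Only the branches matter, so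
  it serves a map and, with the two codes exchanged, its inverse.\<close>

lemma (in forward) accepted_long_words:
  assumes "complete_prefix_code n us" "set vs \<subseteq> words n" "length us = length vs"
    and run: "\<And>i. i < length us \<Longrightarrow> run A (root A) (us ! i) = run A (root A) (vs ! i)"
    and f: "\<And>i \<eta>. \<lbrakk>i < length us; \<eta> \<in> cantor n\<rbrakk> \<Longrightarrow> \<psi> (vs ! i \<frown> \<eta>) = f (\<psi> (us ! i \<frown> \<eta>))"
    and w: "w \<in> words n" "length w \<ge> sum_list (map length us)"
  shows "\<exists>w' \<in> words n. run A (root A) w' = run A (root A) w \<and>
      (\<forall>\<eta> \<in> cantor n. \<psi> (w' \<frown> \<eta>) = f (\<psi> (w \<frown> \<eta>)))"
proof -
  have "n > 0" using n2 by simp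
  from complete_prefix_code_long_word[OF assms(1) this w]
  obtain i z where i: "i < length us" "z \<in> words n" "w = us ! i @ z" .
  show ?thesis
  proof (intro bexI[of _ "vs ! i @ z"] conjI ballI)
    show "run A (root A) (vs ! i @ z) = run A (root A) w"
      using run[OF i(1)] by (simp add: i(3) run_append)
    show "\<psi> ((vs ! i @ z) \<frown> \<eta>) = f (\<psi> (w \<frown> \<eta>))" if "\<eta> \<in> cantor n" for \<eta>
      using f[OF i(1), of "z \<frown> \<eta>"] i that by simp
    show "vs ! i @ z \<in> words n"
      using i assms(2,3) nth_mem[of i vs] by auto
  qed
qed

lemma run_forward_automaton:
  "x \<in> words m \<Longrightarrow> run (forward_automaton n m \<psi> A) (root (forward_automaton n m \<psi> A)) x =
     Some (reach_set n (minimal_transducer n \<psi>) A x)"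
  unfolding forward_automaton_def by (rule run_subset_automaton)

section \<open>The two inclusions\<close>

locale forward_conjugation = forward_homeo +
  fixes \<phi>
  assumes homeo: "homeomorphism (cantor n) (cantor m) \<psi> \<phi>"
    and mono: "monotone_on (cantor n) less_fun less_fun \<psi> \<or>
      monotone_on (cantor n) less_fun (\<lambda>\<omega> \<omega>'. less_fun \<omega>' \<omega>) \<psi>"
begin

lemma phi_psi [simp]: "\<omega> \<in> cantor n \<Longrightarrow> \<phi> (\<psi> \<omega>) = \<omega>"
  and psi_phi [simp]: "\<xi> \<in> cantor m \<Longrightarrow> \<psi> (\<phi> \<xi>) = \<xi>"
  and phi_in_cantor [simp]: "\<xi> \<in> cantor m \<Longrightarrow> \<phi> \<xi> \<in> cantor n"
  and psi_in_cantor [simp]: "\<omega> \<in> cantor n \<Longrightarrow> \<psi> \<omega> \<in> cantor m"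
  using homeo by (auto simp: homeomorphism_def)

lemma inv_into_psi [simp]: "\<xi> \<in> cantor m \<Longrightarrow> inv_into (cantor n) \<psi> \<xi> = \<phi> \<xi>"
  using inv_into_f_f[OF inj phi_in_cantor] by simp

text \<open>A strictly monotone or antitone map also reflects a linear order. The disjunction lets
  both orientations be treated together.\<close>

lemma less_fun_psi_iff:
  shows "(\<forall>\<omega> \<in> cantor n. \<forall>\<eta> \<in> cantor n. less_fun (\<psi> \<omega>) (\<psi> \<eta>) \<longleftrightarrow> less_fun \<omega> \<eta>) \<or>
     (\<forall>\<omega> \<in> cantor n. \<forall>\<eta> \<in> cantor n. less_fun (\<psi> \<omega>) (\<psi> \<eta>) \<longleftrightarrow> less_fun \<eta> \<omega>)"
  using mono
proof
  assume *: "monotone_on (cantor n) less_fun less_fun \<psi>"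
  have "less_fun (\<psi> \<omega>) (\<psi> \<eta>) \<longleftrightarrow> less_fun \<omega> \<eta>" if "\<omega> \<in> cantor n" "\<eta> \<in> cantor n" for \<omega> \<eta>
    using monotone_onD[OF *] that less_fun_linear[of \<omega> \<eta>] less_fun_asym less_fun_irrefl by metis
  then show ?thesis by blast
next
  assume *: "monotone_on (cantor n) less_fun (\<lambda>\<omega> \<omega>'. less_fun \<omega>' \<omega>) \<psi>"
  have "less_fun (\<psi> \<omega>) (\<psi> \<eta>) \<longleftrightarrow> less_fun \<eta> \<omega>" if "\<omega> \<in> cantor n" "\<eta> \<in> cantor n" for \<omega> \<eta>
    using monotone_onD[OF *] that less_fun_linear[of \<omega> \<eta>] less_fun_asym less_fun_irrefl by metis
  then show ?thesis by blast
qed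

text \<open>Acceptance equates the sets R of each branch pair of \<open>f\<close>; around every
  point \<open>common_states_branch\<close> turns such a pair into one for the conjugate
  \<open>h\<close> with equal states of \<open>A\<close>.\<close>

lemma diagram_group_forward_subset:
  assumes f: "f \<in> diagram_group m (forward_automaton n m \<psi> A)"
  shows "f \<in> conjugate n m \<psi> (diagram_group n A)"
proof -
  obtain xs ys g where ext: "f \<in> extensional (cantor m)"
    and fg: "homeomorphism (cantor m) (cantor m) f g"
    and fmono: "monotone_on (cantor m) less_fun less_fun f"
    and diag: "tree_diagram m xs ys f" and acc: "accepted (forward_automaton n m \<psi> A) xs ys"
    using f unfolding diagram_group_def thompson_F_def by blast
  have fm [simp]: "f \<xi> \<in> cantor m" if "\<xi> \<in> cantor m" for \<xi>
    using fg that by (auto simp: homeomorphism_def)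
  define h where "h = restrict (\<phi> \<circ> f \<circ> \<psi>) (cantor n)"
  have h: "h \<omega> = \<phi> (f (\<psi> \<omega>))" if "\<omega> \<in> cantor n" for \<omega>
    using that by (simp add: h_def)
  have "h \<in> diagram_group n A"
  proof (rule diagram_groupI)
    show "n > 0" using n2 by simp
    show "h \<in> extensional (cantor n)"
      by (simp add: h_def)
    have "homeomorphism (cantor n) (cantor n) (\<phi> \<circ> (f \<circ> \<psi>)) ((\<phi> \<circ> g) \<circ> \<psi>)"
      by (rule homeomorphism_compose[OF homeomorphism_compose[OF homeo fg] homeomorphism_symD[OF homeo]])
    then show "homeomorphism (cantor n) (cantor n) h ((\<phi> \<circ> g) \<circ> \<psi>)"
      by (rule homeomorphism_cong) (simp_all add: h)
    show "monotone_on (cantor n) less_fun less_fun h"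
    proof (rule monotone_onI)
      fix \<omega> \<eta> assume *: "\<omega> \<in> cantor n" "\<eta> \<in> cantor n" "less_fun \<omega> \<eta>"
      \<comment> \<open>Which implication applies depends on the orientation of
        \<open>\<psi>\<close>; a reversal occurs twice in the conjugation and cancels.\<close>
      have "less_fun (\<psi> \<omega>) (\<psi> \<eta>) \<Longrightarrow> less_fun (\<psi> (h \<omega>)) (\<psi> (h \<eta>))"
        and "less_fun (\<psi> \<eta>) (\<psi> \<omega>) \<Longrightarrow> less_fun (\<psi> (h \<eta>)) (\<psi> (h \<omega>))"
        using monotone_onD[OF fmono] * by (simp_all add: h)
      moreover have "h \<omega> \<in> cantor n" "h \<eta> \<in> cantor n"
        using * by (simp_all add: h)
      ultimately show "less_fun (h \<omega>) (h \<eta>)"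
        using less_fun_psi_iff * by blast
    qed
    show "\<exists>u v. \<omega> \<in> cylinder n u \<and> u \<in> words n \<and> v \<in> words n \<and>
        (\<forall>\<eta> \<in> cantor n. h (u \<frown> \<eta>) = v \<frown> \<eta>) \<and> run A (root A) u = run A (root A) v"
      if \<omega>: "\<omega> \<in> cantor n" for \<omega>
    proof -
      have codes: "complete_prefix_code m xs" "complete_prefix_code m ys" "length xs = length ys"
        using diag by (auto simp: tree_diagram_def)
      obtain i \<xi> where i: "i < length xs" "\<xi> \<in> cantor m" "\<psi> \<omega> = xs ! i \<frown> \<xi>"
        using complete_prefix_code_cover[OF codes(1) psi_in_cantor[OF \<omega>]] .
      have xy: "xs ! i \<in> words m" "ys ! i \<in> words m"
        using codes i(1) nth_mem[of i xs] nth_mem[of i ys]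
        by (auto simp: complete_prefix_code_def)
      have "R (xs ! i) \<subseteq> R (ys ! i)"
        using acc i(1) xy by (auto simp: accepted_def run_forward_automaton)
      from common_states_branch[OF this \<omega> i(3)] obtain u v z where
        uv: "u \<in> words n" "v \<in> words n" "\<omega> \<in> cylinder n u"
          "run A (root A) u = run A (root A) v" and z: "z \<in> words m" and
        \<psi>u: "\<And>\<eta>. \<eta> \<in> cantor n \<Longrightarrow> \<psi> (u \<frown> \<eta>) = (xs ! i @ z) \<frown> local_action n \<psi> u \<eta>" and
        \<psi>v: "\<And>\<eta>. \<eta> \<in> cantor n \<Longrightarrow> \<psi> (v \<frown> \<eta>) = (ys ! i @ z) \<frown> local_action n \<psi> u \<eta>"
        by blast
      have "h (u \<frown> \<eta>) = v \<frown> \<eta>" if \<eta>: "\<eta> \<in> cantor n" for \<eta>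
      proof -
        let ?\<zeta> = "z \<frown> local_action n \<psi> u \<eta>"
        have "?\<zeta> \<in> cantor m"
          using z local_action_in_cantor[OF uv(1) \<eta>] by simp
        then have "f (xs ! i \<frown> ?\<zeta>) = ys ! i \<frown> ?\<zeta>"
          using diag i(1) unfolding tree_diagram_def by blast
        then have "f (\<psi> (u \<frown> \<eta>)) = \<psi> (v \<frown> \<eta>)"
          using \<psi>u[OF \<eta>] \<psi>v[OF \<eta>] by simp
        then show ?thesis
          using uv \<eta> by (simp add: h)
      qed
      then show ?thesis
        using uv by blast
    qed
  qed (rule full)
  moreover have "f = restrict (\<lambda>\<xi>. \<psi> (h (inv_into (cantor n) \<psi> \<xi>))) (cantor m)"
  proof
    fix \<xi> show "f \<xi> = restrict (\<lambda>\<xi>. \<psi> (h (inv_into (cantor n) \<psi> \<xi>))) (cantor m) \<xi>"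
      using ext by (cases "\<xi> \<in> cantor m") (simp_all add: h extensional_def)
  qed
  ultimately show ?thesis
    unfolding conjugate_def by blast
qed

text \<open>Equality of the sets R comes from two inclusions: \<open>reach_set_mono\<close> for
  \<open>f\<close> with the diagram of \<open>h\<close>, and for its inverse \<open>g\<close> with
  that diagram reversed.\<close>

lemma conjugate_subset_diagram_group_forward:
  assumes conj: "f \<in> conjugate n m \<psi> (diagram_group n A)" and f: "f \<in> thompson_F m"
  shows "f \<in> diagram_group m (forward_automaton n m \<psi> A)"
proof -
  obtain h where h: "h \<in> diagram_group n A"
    and fh: "f = restrict (\<lambda>\<xi>. \<psi> (h (inv_into (cantor n) \<psi> \<xi>))) (cantor m)"
    using conj unfolding conjugate_def by blast
  obtain us vs where hd: "tree_diagram n us vs h" and acc: "accepted A us vs"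
    using h unfolding diagram_group_def by blast
  obtain xs ys g where ext: "f \<in> extensional (cantor m)"
    and fg: "homeomorphism (cantor m) (cantor m) f g"
    and fmono: "monotone_on (cantor m) less_fun less_fun f" and fd: "tree_diagram m xs ys f"
    using f unfolding thompson_F_def by blast
  have us: "complete_prefix_code n us" "complete_prefix_code n vs" "length us = length vs"
      "set us \<subseteq> words n" "set vs \<subseteq> words n"
    using hd by (auto simp: tree_diagram_def complete_prefix_code_def)
  have run: "run A (root A) (us ! i) = run A (root A) (vs ! i)" if "i < length us" for i
    using acc that by (simp add: accepted_def)
  then have run': "run A (root A) (vs ! i) = run A (root A) (us ! i)" if "i < length vs" for i
    using that us(3) by simp
  have f\<psi>: "\<psi> (vs ! i \<frown> \<eta>) = f (\<psi> (us ! i \<frown> \<eta>))" if "i < length us" "\<eta> \<in> cantor n" for i \<eta>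
  proof -
    have "us ! i \<frown> \<eta> \<in> cantor n"
      using us that nth_mem[of i us] by auto
    then show ?thesis
      using hd that by (simp add: fh tree_diagram_def)
  qed
  have gf: "g (f \<xi>) = \<xi>" if "\<xi> \<in> cantor m" for \<xi>
    using fg that by (auto simp: homeomorphism_def)
  have g\<psi>: "\<psi> (us ! i \<frown> \<eta>) = g (\<psi> (vs ! i \<frown> \<eta>))" if "i < length vs" "\<eta> \<in> cantor n" for i \<eta>
  proof -
    have "us ! i \<frown> \<eta> \<in> cantor n"
      using us that nth_mem[of i us] by auto
    then show ?thesis
      using f\<psi>[of i \<eta>] us(3) that by (simp add: gf)
  qed
  have xs: "complete_prefix_code m xs" "complete_prefix_code m ys" "length xs = length ys"
      "set xs \<subseteq> words m" "set ys \<subseteq> words m"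
    using fd by (auto simp: tree_diagram_def complete_prefix_code_def)
  have fx: "\<forall>\<xi> \<in> cantor m. f (xs ! i \<frown> \<xi>) = ys ! i \<frown> \<xi>" if "i < length xs" for i
    using fd that by (simp add: tree_diagram_def)
  have gy: "\<forall>\<xi> \<in> cantor m. g (ys ! i \<frown> \<xi>) = xs ! i \<frown> \<xi>" if "i < length xs" for i
  proof
    fix \<xi> assume \<xi>: "\<xi> \<in> cantor m"
    then have "xs ! i \<frown> \<xi> \<in> cantor m"
      using xs that nth_mem[of i xs] by auto
    then show "g (ys ! i \<frown> \<xi>) = xs ! i \<frown> \<xi>"
      using fx[OF that] \<xi> gf by metis
  qed
  \<comment> \<open>The sum of lengths bounds every branch word of \<open>f\<close>, so one
    \<open>N1\<close> works for all branches.\<close>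
  obtain N1 where N1: "\<And>x y z. \<lbrakk>length x \<le> sum_list (map length xs);
      \<forall>\<xi> \<in> cantor m. f (x \<frown> \<xi>) = y \<frown> \<xi>; z \<in> words m; length z \<ge> N1\<rbrakk> \<Longrightarrow> R (x @ z) \<subseteq> R (y @ z)"
    by (rule reach_set_mono[OF accepted_long_words[OF us(1,5,3) run f\<psi>],
          where L = "sum_list (map length xs)"]) blast+
  obtain N2 where N2: "\<And>x y z. \<lbrakk>length x \<le> sum_list (map length ys);
      \<forall>\<xi> \<in> cantor m. g (x \<frown> \<xi>) = y \<frown> \<xi>; z \<in> words m; length z \<ge> N2\<rbrakk> \<Longrightarrow> R (x @ z) \<subseteq> R (y @ z)"
    by (rule reach_set_mono[OF accepted_long_words[OF us(2,4) us(3)[symmetric] run' g\<psi>],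
          where L = "sum_list (map length ys)"]) blast+
  show ?thesis
  proof (rule diagram_groupI[OF _ ext fg fmono])
    show "m > 0" using m2 by simp
    show "full_tree_automaton m (forward_automaton n m \<psi> A)"
      unfolding forward_automaton_def by (rule full_tree_automaton_subset_automaton)
    let ?F = "forward_automaton n m \<psi> A"
    show "\<exists>x y. \<zeta> \<in> cylinder m x \<and> x \<in> words m \<and> y \<in> words m \<and>
        (\<forall>\<xi> \<in> cantor m. f (x \<frown> \<xi>) = y \<frown> \<xi>) \<and> run ?F (root ?F) x = run ?F (root ?F) y"
      if \<zeta>: "\<zeta> \<in> cantor m" for \<zeta>
    proof -
      obtain i \<xi> where i: "i < length xs" "\<xi> \<in> cantor m" "\<zeta> = xs ! i \<frown> \<xi>"
        using complete_prefix_code_cover[OF xs(1) \<zeta>] .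
      \<comment> \<open>Lengthening both branch words by the next \<open>N\<close> letters of the
        point keeps them a branch pair and makes both inclusions available.\<close>
      define N where "N = max N1 N2"
      define z where "z = subsequence \<xi> 0 N"
      have z: "z \<in> words m" "length z \<ge> N1" "length z \<ge> N2"
        using i(2) by (simp_all add: z_def N_def)
      have xy: "xs ! i @ z \<in> words m" "ys ! i @ z \<in> words m"
        using xs i z nth_mem[of i xs] nth_mem[of i ys] by auto
      have len: "length (xs ! i) \<le> sum_list (map length xs)" "length (ys ! i) \<le> sum_list (map length ys)"
        using i(1) xs(3) by (auto intro!: member_le_sum_list)
      have "R (xs ! i @ z) = R (ys ! i @ z)"
        using N1[OF len(1) fx[OF i(1)] z(1,2)] N2[OF len(2) gy[OF i(1)] z(1,3)] by blast
      moreover have "\<zeta> = (xs ! i @ z) \<frown> Omega_Words_Fun.suffix N \<xi>"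
        using i(3) by (simp add: z_def flip: conc_conc)
      then have "\<zeta> \<in> cylinder m (xs ! i @ z)"
        using i(2) unfolding mem_cylinder by (intro bexI[of _ "Omega_Words_Fun.suffix N \<xi>"]) auto
      moreover have "f ((xs ! i @ z) \<frown> \<eta>) = (ys ! i @ z) \<frown> \<eta>" if "\<eta> \<in> cantor m" for \<eta>
        using bspec[OF fx[OF i(1)], of "z \<frown> \<eta>"] z(1) that by simp
      ultimately show ?thesis
        using xy by (intro exI[of _ "xs ! i @ z"] exI[of _ "ys ! i @ z"]) (simp add: run_forward_automaton)
    qed
  qed
qed

end

theorem corollary5p16:
  fixes n m :: nat
    and \<psi> :: "(nat \<Rightarrow> nat) \<Rightarrow> (nat \<Rightarrow> nat)"
    and A :: "'q automaton"
  assumes "n \<ge> 2" and "m \<ge> 2"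
    and "\<exists>\<phi>. homeomorphism (cantor n) (cantor m) \<psi> \<phi>"
    and "monotone_on (cantor n) less_fun less_fun \<psi> \<or>
         monotone_on (cantor n) less_fun (\<lambda>\<omega> \<omega>'. less_fun \<omega>' \<omega>) \<psi>"
    and "full_tree_automaton n A"
  shows "diagram_group m (forward_automaton n m \<psi> A)
           = conjugate n m \<psi> (diagram_group n A) \<inter> thompson_F m
       \<and> (conjugate n m \<psi> (diagram_group n A) \<subseteq> thompson_F m \<longrightarrow>
          diagram_group m (forward_automaton n m \<psi> A) = conjugate n m \<psi> (diagram_group n A))"
proof -
  obtain \<phi> where \<phi>: "homeomorphism (cantor n) (cantor m) \<psi> \<phi>"
    using assms(3) by blast
  interpret forward_conjugation n m \<psi> A \<phi>
  proof
    show "inj_on \<psi> (cantor n)"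
      using homeomorphism_imp_bij_betw[OF \<phi>] by (rule bij_betw_imp_inj_on)
  qed (use assms \<phi> in \<open>auto simp: homeomorphism_def\<close>)
  have "diagram_group m (forward_automaton n m \<psi> A) \<subseteq> thompson_F m"
    by (auto simp: diagram_group_def)
  then have "diagram_group m (forward_automaton n m \<psi> A)
      = conjugate n m \<psi> (diagram_group n A) \<inter> thompson_F m"
    using diagram_group_forward_subset conjugate_subset_diagram_group_forward by blast
  then show ?thesis by blast
qed

end
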